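(* Let $I_0$ be a finite open interval of $\mathbb{R}$ and let $f\in C^{(3)}(I_0)$ satisfy $$0<\inf_{x\in I_0}|f''(x)|\le\sup_{x\in I_0}|f''(x)|<\infty.$$ Let $I\subseteq I_0$ be an interval. Let $\psi$ be an approximating function satisfying $$\lim_{t\to+\infty}\psi(t)=\lim_{t\to+\infty}\frac{1}{t\psi(t)}=0.$$ Then there exists a constant $c>0$, depending on $I$, such that for all sufficiently large $Q$ $$N_f(Q,\psi,I)\ \ge\ c\,Q^2\,\psi(Q)\,|I|.$$
   Context: An approximating function is a decreasing function $\psi:\mathbb{R}^+\to\mathbb{R}^+$. Every point of $\mathbb{Q}^2$ is written uniquely as $\mathbf{p}/q=(p_1/q,p_2/q)$ with $(p_1,p_2)\in\mathbb{Z}^2$ and $q\in\mathbb{N}$ the smallest positive integer such that $q$ times the point lies in $\mathbb{Z}^2$. For $Q\in\mathbb{R}^+$, $$N_f(Q,\psi,I):=\#\{\mathbf{p}/q\in\mathbb{Q}^2: q\le Q,\ p_1/q\in I,\ |f(p_1/q)-p_2/q|<\psi(Q)/Q\}.$$ $|I|$ is the length of $I$; $C^{(3)}(I_0)$ is the set of 3-times continuously differentiable functions on $I_0$. *)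

theory Defs
  imports "HOL-Analysis.Analysis"
begin

(* Functions are total on the type real; only their values on the positive half-line matter. *)
definition approximating_function :: "(real \<Rightarrow> real) \<Rightarrow> bool" where
  "approximating_function \<psi> \<longleftrightarrow> (\<forall>t>0. \<psi> t > 0) \<and> antimono_on {0<..} \<psi>"

(* Intended for open S, where the iterated derivatives on S depend only on f restricted to S.
   Continuity of the derivatives of order below k follows from their differentiability. *)
definition Ck_on :: "nat \<Rightarrow> (real \<Rightarrow> real) \<Rightarrow> real set \<Rightarrow> bool" where
  "Ck_on k f S \<longleftrightarrow>
     (\<forall>i<k. \<forall>x\<in>S. (deriv ^^ i) f field_differentiable (at x)) \<and>
     continuous_on S ((deriv ^^ k) f)"

(* The q in the unique representation (p1/q, p2/q) of a point of the rational plane. *)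
definition common_denom :: "real \<times> real \<Rightarrow> nat" where
  "common_denom v = (LEAST q. q > 0 \<and> of_nat q * fst v \<in> \<int> \<and> of_nat q * snd v \<in> \<int>)"

(* The cardinality is 0 for an infinite set; the set is finite whenever I and f ` I are bounded. *)
definition N_count :: "(real \<Rightarrow> real) \<Rightarrow> real \<Rightarrow> (real \<Rightarrow> real) \<Rightarrow> real set \<Rightarrow> nat" where
  "N_count f Q \<psi> I =
     card {v \<in> \<rat> \<times> \<rat>. real (common_denom v) \<le> Q \<and> fst v \<in> I \<and>
                        \<bar>f (fst v) - snd v\<bar> < \<psi> Q / Q}"

end

theory Submission
  imports Defs
begin

text \<open>By the pigeonhole principle every x admits an integer vector (q, p, r) with 0 < q, q \<le> Q,
  q x - p = O(1/(\<psi> Q)) and q f(x) - f'(x) (q x - p) - r = O(\<psi>). If q is at least a fixed multiple of Q,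
  Taylor's formula shows that (p/q, r/q) is counted, and its first coordinate lies within
  O(1/(\<psi> Q^2)) of x. So it suffices that the x for which q can be small fill at most half of an
  interval inside I; the intervals around the counted points then cover the other half.

  The exceptional set is estimated by quantitative nondivergence in the style of Kleinbock and
  Margulis, which in dimension three can be done by hand. After rescaling, x is exceptional if some
  nonzero integer vector has norm at most e at x, for a norm depending on x. Each form of a vector is,
  up to a bounded factor, the derivative of the next one, so the set where a single vector is much
  shorter than its maximum over an interval occupies only a small part of that interval. To pass
  to all vectors at once, one works simultaneously with the dual norms (the lines of the plane) and
  divides the interval according to the vector or dual vector that stays short for longest.\<close>

text \<open>Adding up the estimate for one vector over all vectors that may be short would lose a
  factor growing with Q. Longest intervals avoid this: on such an interval every member of the
  family has reached the level 1/5, so each estimate is relative to that same interval, and the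
  sweep costs only a factor 2. Two rounds suffice. The first picks a point or line u, the second a
  companion of the other kind incident with u; a point together with a line through it is a full
  flag in dimension three, so there is nothing further to choose.

  The exceptional proportion comes out as 6 * 16 * (M / m) * sqrt (5 * e), free of Q and \<psi>.
  Hence e, and with it the constant of the theorem, is fixed before \<psi>. The square root reflects
  that the last form behaves like a quadratic polynomial, because |f''| is bounded away from 0. Q
  and \<psi> enter only through weights of product 1, which must keep every nonzero vector from
  staying below 1/5 on the whole interval; this is where Q has to be large.\<close>

section \<open>Sublevel sets of functions whose successive derivatives are comparable\<close>

lemma peel_interval:
  fixes E :: "real set"
  assumes "compact E" "measure lebesgue E > c" "c \<ge> 0" "\<sigma> \<ge> 0"
  obtains x where "x \<in> E" "compact (E \<inter> {x + \<sigma>..})" "measure lebesgue (E \<inter> {x + \<sigma>..}) > c - \<sigma>"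
proof -
  have "E \<noteq> {}" using assms by auto
  then obtain x where x: "x \<in> E" "\<And>y. y \<in> E \<Longrightarrow> x \<le> y"
    using compact_attains_inf[OF assms(1)] by blast
  have cpt: "compact (E \<inter> {x + \<sigma>..})" using assms(1) by (intro compact_Int_closed) auto
  have "measure lebesgue E \<le> measure lebesgue ({x..x + \<sigma>} \<union> (E \<inter> {x + \<sigma>..}))"
    using x assms(1) cpt by (intro measure_mono_fmeasurable)
      (auto intro!: fmeasurable.Un lmeasurable_compact intro: fmeasurableD)
  also have "\<dots> \<le> measure lebesgue {x..x + \<sigma>} + measure lebesgue (E \<inter> {x + \<sigma>..})"
    by (intro measure_Un_le lmeasurable_compact fmeasurableD cpt) auto
  also have "measure lebesgue {x..x + \<sigma>} = \<sigma>" using assms(4) by simp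
  finally show thesis using that x(1) cpt assms(2) by fastforce
qed

text \<open>Three cuts, each starting at the leftmost remaining point, remove measure at most 3 *
  \<sigma>, so a fourth point is left. Four points are used because two disjoint pairs give two
  values of a first derivative, and these two give the second.\<close>

lemma four_separated_points:
  fixes E :: "real set"
  assumes "compact E" "measure lebesgue E > 3 * \<sigma>" "\<sigma> \<ge> 0"
  obtains x1 x2 x3 x4 where "x1 \<in> E" "x2 \<in> E" "x3 \<in> E" "x4 \<in> E"
    "x1 + \<sigma> \<le> x2" "x2 + \<sigma> \<le> x3" "x3 + \<sigma> \<le> x4"
proof -
  have nn: "0 \<le> 3 * \<sigma>" "0 \<le> 3 * \<sigma> - \<sigma>" "0 \<le> 3 * \<sigma> - \<sigma> - \<sigma>" using assms by auto
  obtain x1 where x1: "x1 \<in> E" "compact (E \<inter> {x1 + \<sigma>..})"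
      "measure lebesgue (E \<inter> {x1 + \<sigma>..}) > 3 * \<sigma> - \<sigma>"
    by (rule peel_interval[OF assms(1,2) nn(1) assms(3)])
  obtain x2 where x2: "x2 \<in> E \<inter> {x1 + \<sigma>..}" "compact (E \<inter> {x1 + \<sigma>..} \<inter> {x2 + \<sigma>..})"
      "measure lebesgue (E \<inter> {x1 + \<sigma>..} \<inter> {x2 + \<sigma>..}) > 3 * \<sigma> - \<sigma> - \<sigma>"
    by (rule peel_interval[OF x1(2,3) nn(2) assms(3)])
  obtain x3 where x3: "x3 \<in> E \<inter> {x1 + \<sigma>..} \<inter> {x2 + \<sigma>..}"
      "compact (E \<inter> {x1 + \<sigma>..} \<inter> {x2 + \<sigma>..} \<inter> {x3 + \<sigma>..})"
      "measure lebesgue (E \<inter> {x1 + \<sigma>..} \<inter> {x2 + \<sigma>..} \<inter> {x3 + \<sigma>..}) > 3 * \<sigma> - \<sigma> - \<sigma> - \<sigma>"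
    by (rule peel_interval[OF x2(2,3) nn(3) assms(3)])
  have "E \<inter> {x1 + \<sigma>..} \<inter> {x2 + \<sigma>..} \<inter> {x3 + \<sigma>..} \<noteq> {}"
    using x3(3) by auto
  then show thesis using that x1(1) x2(1) x3(1) by auto
qed

text \<open>The coefficient forms of a point, and those of a line, are each of this shape: up to the
  bounded factors h, every one is the derivative of the next.\<close>
definition derivative_chain ::
    "real \<Rightarrow> real \<Rightarrow> real set \<Rightarrow> real \<Rightarrow> (real \<Rightarrow> real) \<Rightarrow> (real \<Rightarrow> real) \<Rightarrow> bool" where
  "derivative_chain m M S p0 p1 p2 \<longleftrightarrow>
     (\<exists>h1 h2. \<forall>x\<in>S. (p1 has_real_derivative p0 * h1 x) (at x) \<and> m \<le> \<bar>h1 x\<bar> \<and> \<bar>h1 x\<bar> \<le> M \<and>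
                   (p2 has_real_derivative p1 x * h2 x) (at x) \<and> m \<le> \<bar>h2 x\<bar> \<and> \<bar>h2 x\<bar> \<le> M)"

lemma derivative_chain_subset:
  "derivative_chain m M S p0 p1 p2 \<Longrightarrow> T \<subseteq> S \<Longrightarrow> derivative_chain m M T p0 p1 p2"
  unfolding derivative_chain_def by blast

lemma derivative_chain_continuous:
  assumes "derivative_chain m M S p0 p1 p2"
  shows "continuous_on S p1" "continuous_on S p2"
  using assms unfolding derivative_chain_def
  by (meson DERIV_isCont continuous_at_imp_continuous_on)+

lemma derivative_chain_mvt:
  assumes "derivative_chain m M {c..d} p0 p1 p2" "0 < m" "c \<le> x" "x < y" "y \<le> d"
  shows "\<bar>p0\<bar> * m * (y - x) \<le> \<bar>p1 y - p1 x\<bar>" "\<bar>p1 y - p1 x\<bar> \<le> \<bar>p0\<bar> * M * (y - x)"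
    "\<exists>\<xi>. x < \<xi> \<and> \<xi> < y \<and> \<bar>p1 \<xi>\<bar> * m * (y - x) \<le> \<bar>p2 y - p2 x\<bar> \<and>
          \<bar>p2 y - p2 x\<bar> \<le> \<bar>p1 \<xi>\<bar> * M * (y - x)"
proof -
  obtain h1 h2 where h:
    "\<And>x. x \<in> {c..d} \<Longrightarrow> (p1 has_real_derivative p0 * h1 x) (at x)"
    "\<And>x. x \<in> {c..d} \<Longrightarrow> m \<le> \<bar>h1 x\<bar> \<and> \<bar>h1 x\<bar> \<le> M"
    "\<And>x. x \<in> {c..d} \<Longrightarrow> (p2 has_real_derivative p1 x * h2 x) (at x)"
    "\<And>x. x \<in> {c..d} \<Longrightarrow> m \<le> \<bar>h2 x\<bar> \<and> \<bar>h2 x\<bar> \<le> M"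
    using assms(1) unfolding derivative_chain_def by blast
  obtain z where z: "x < z" "z < y" "p1 y - p1 x = (y - x) * (p0 * h1 z)"
    using MVT2[OF assms(4), of p1 "\<lambda>z. p0 * h1 z"] h(1) assms by auto
  have hz: "m \<le> \<bar>h1 z\<bar>" "\<bar>h1 z\<bar> \<le> M" using h(2)[of z] z assms by auto
  have e: "\<bar>p1 y - p1 x\<bar> = \<bar>p0\<bar> * \<bar>h1 z\<bar> * (y - x)"
    using z assms by (simp add: abs_mult)
  show "\<bar>p0\<bar> * m * (y - x) \<le> \<bar>p1 y - p1 x\<bar>" "\<bar>p1 y - p1 x\<bar> \<le> \<bar>p0\<bar> * M * (y - x)"
    unfolding e using hz assms by (auto intro!: mult_right_mono mult_left_mono)
  obtain w where w: "x < w" "w < y" "p2 y - p2 x = (y - x) * (p1 w * h2 w)"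
    using MVT2[OF assms(4), of p2 "\<lambda>z. p1 z * h2 z"] h(3) assms by auto
  have hw: "m \<le> \<bar>h2 w\<bar>" "\<bar>h2 w\<bar> \<le> M" using h(4)[of w] w assms by auto
  have e2: "\<bar>p2 y - p2 x\<bar> = \<bar>p1 w\<bar> * \<bar>h2 w\<bar> * (y - x)"
    using w assms by (simp add: abs_mult)
  show "\<exists>\<xi>. x < \<xi> \<and> \<xi> < y \<and> \<bar>p1 \<xi>\<bar> * m * (y - x) \<le> \<bar>p2 y - p2 x\<bar> \<and>
          \<bar>p2 y - p2 x\<bar> \<le> \<bar>p1 \<xi>\<bar> * M * (y - x)"
    unfolding e2 using hw assms w by (intro exI[of _ w]) (auto intro!: mult_right_mono mult_left_mono)
qed

lemma derivative_chain_growth: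
  assumes "derivative_chain m M {c..d} p0 p1 p2" "0 < m" "m \<le> M" "c \<le> x" "x \<le> d" "c \<le> y" "y \<le> d"
  shows "\<bar>p1 y\<bar> \<le> \<bar>p1 x\<bar> + \<bar>p0\<bar> * M * (d - c)"
    and "(\<And>z. c \<le> z \<Longrightarrow> z \<le> d \<Longrightarrow> \<bar>p1 z\<bar> \<le> B) \<Longrightarrow> \<bar>p2 y\<bar> \<le> \<bar>p2 x\<bar> + B * M * (d - c)"
proof -
  have "\<bar>p1 y - p1 x\<bar> \<le> \<bar>p0\<bar> * M * \<bar>y - x\<bar>"
  proof (cases x y rule: linorder_cases)
    case less
    then show ?thesis using derivative_chain_mvt(2)[OF assms(1,2), of x y] assms by simp
  next
    case greater
    then show ?thesis using derivative_chain_mvt(2)[OF assms(1,2), of y x] assms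
      by (simp add: abs_minus_commute)
  qed auto
  also have "\<dots> \<le> \<bar>p0\<bar> * M * (d - c)" using assms by (intro mult_left_mono) auto
  finally show "\<bar>p1 y\<bar> \<le> \<bar>p1 x\<bar> + \<bar>p0\<bar> * M * (d - c)" by linarith
  assume B: "\<And>z. c \<le> z \<Longrightarrow> z \<le> d \<Longrightarrow> \<bar>p1 z\<bar> \<le> B"
  have B0: "0 \<le> B" using B[of x] assms by linarith
  have bd: "\<bar>p2 v - p2 u\<bar> \<le> B * M * (v - u)" if uv: "c \<le> u" "u < v" "v \<le> d" for u v
  proof -
    obtain \<xi> where \<xi>: "u < \<xi>" "\<xi> < v" "\<bar>p2 v - p2 u\<bar> \<le> \<bar>p1 \<xi>\<bar> * M * (v - u)"
      using derivative_chain_mvt(3)[OF assms(1,2) uv] by blast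
    have "\<bar>p1 \<xi>\<bar> * M * (v - u) \<le> B * M * (v - u)"
      using B[of \<xi>] \<xi> uv assms by (intro mult_right_mono) auto
    then show ?thesis using \<xi>(3) by linarith
  qed
  have "\<bar>p2 y - p2 x\<bar> \<le> B * M * \<bar>y - x\<bar>"
  proof (cases x y rule: linorder_cases)
    case less
    then show ?thesis using bd[of x y] assms by simp
  next
    case greater
    then show ?thesis using bd[of y x] assms by (simp add: abs_minus_commute)
  qed auto
  also have "\<dots> \<le> B * M * (d - c)" using assms B0 by (intro mult_left_mono) auto
  finally show "\<bar>p2 y\<bar> \<le> \<bar>p2 x\<bar> + B * M * (d - c)" by linarith
qed

text \<open>The mean value theorem turns two small values of \<open>p1\<close> into a bound for
  \<open>p0\<close>. Integrating back bounds \<open>p1\<close> everywhere, at the price of the ratio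
  of the interval length to the gap \<sigma>.\<close>

lemma derivative_chain_two_points:
  assumes ch: "derivative_chain m M {c..d} p0 p1 p2" "0 < m" "m \<le> M" and \<sigma>: "0 < \<sigma>"
    and x: "c \<le> x1" "x1 + \<sigma> \<le> x2" "x2 \<le> d" "\<bar>p1 x1\<bar> \<le> \<eta>" "\<bar>p1 x2\<bar> \<le> \<eta>"
  shows "\<bar>p0\<bar> \<le> 2 * \<eta> / (m * \<sigma>)"
    and "c \<le> y \<Longrightarrow> y \<le> d \<Longrightarrow> \<bar>p1 y\<bar> \<le> \<eta> * (1 + 2 * (M * (d - c) / (m * \<sigma>)))"
proof -
  have "\<bar>p0\<bar> * m * \<sigma> \<le> \<bar>p0\<bar> * m * (x2 - x1)" using x ch by (intro mult_left_mono) auto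
  also have "\<dots> \<le> \<bar>p1 x2 - p1 x1\<bar>" using derivative_chain_mvt(1)[OF ch(1,2)] x \<sigma> by auto
  also have "\<dots> \<le> 2 * \<eta>" using x by linarith
  finally show p0: "\<bar>p0\<bar> \<le> 2 * \<eta> / (m * \<sigma>)" using ch \<sigma> by (simp add: field_simps)
  assume y: "c \<le> y" "y \<le> d"
  have "\<bar>p1 y\<bar> \<le> \<bar>p1 x1\<bar> + \<bar>p0\<bar> * M * (d - c)"
    using derivative_chain_growth(1)[OF ch] x \<sigma> y by auto
  also have "\<bar>p0\<bar> * M * (d - c) \<le> 2 * \<eta> / (m * \<sigma>) * M * (d - c)"
    using p0 x \<sigma> ch by (intro mult_right_mono) auto
  finally show "\<bar>p1 y\<bar> \<le> \<eta> * (1 + 2 * (M * (d - c) / (m * \<sigma>)))"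
    using x by (simp add: field_simps)
qed

text \<open>Each of the pairs x1, x2 and x3, x4 contains a point between them where
  \<open>p1\<close> is small. The gap from x2 to x3 keeps these two points \<sigma> apart, so the
  two-point bound applies to them. Z is the loss of one integration.\<close>

lemma derivative_chain_four_points:
  assumes ch: "derivative_chain m M {c..d} p0 p1 p2" "0 < m" "m \<le> M" and \<sigma>: "0 < \<sigma>"
    and x: "c \<le> x1" "x1 + \<sigma> \<le> x2" "x2 + \<sigma> \<le> x3" "x3 + \<sigma> \<le> x4" "x4 \<le> d"
      "\<bar>p2 x1\<bar> \<le> \<eta>" "\<bar>p2 x2\<bar> \<le> \<eta>" "\<bar>p2 x3\<bar> \<le> \<eta>" "\<bar>p2 x4\<bar> \<le> \<eta>"
  defines "Z \<equiv> M * (d - c) / (m * \<sigma>)"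
  shows "\<bar>p0\<bar> \<le> 4 * \<eta> / (m * \<sigma>)\<^sup>2"
    and "c \<le> y \<Longrightarrow> y \<le> d \<Longrightarrow> \<bar>p1 y\<bar> \<le> 2 * \<eta> / (m * \<sigma>) * (1 + 2 * Z)"
    and "c \<le> y \<Longrightarrow> y \<le> d \<Longrightarrow> \<bar>p2 y\<bar> \<le> \<eta> * (1 + 2 * Z + 4 * Z\<^sup>2)"
proof -
  have pt: "\<exists>\<xi>. u < \<xi> \<and> \<xi> < v \<and> \<bar>p1 \<xi>\<bar> \<le> 2 * \<eta> / (m * \<sigma>)"
    if uv: "c \<le> u" "u + \<sigma> \<le> v" "v \<le> d" "\<bar>p2 u\<bar> \<le> \<eta>" "\<bar>p2 v\<bar> \<le> \<eta>" for u v
  proof -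
    obtain \<xi> where \<xi>: "u < \<xi>" "\<xi> < v" "\<bar>p1 \<xi>\<bar> * m * (v - u) \<le> \<bar>p2 v - p2 u\<bar>"
      using derivative_chain_mvt(3)[OF ch(1,2), of u v] uv \<sigma> by auto
    have "\<bar>p1 \<xi>\<bar> * m * \<sigma> \<le> \<bar>p1 \<xi>\<bar> * m * (v - u)" using uv ch by (intro mult_left_mono) auto
    also have "\<dots> \<le> 2 * \<eta>" using \<xi>(3) uv by linarith
    finally show ?thesis using \<xi> ch \<sigma> by (intro exI[of _ \<xi>]) (auto simp: field_simps)
  qed
  obtain \<xi>1 where \<xi>1: "x1 < \<xi>1" "\<xi>1 < x2" "\<bar>p1 \<xi>1\<bar> \<le> 2 * \<eta> / (m * \<sigma>)"
    using pt[of x1 x2] x \<sigma> by auto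
  obtain \<xi>2 where \<xi>2: "x3 < \<xi>2" "\<xi>2 < x4" "\<bar>p1 \<xi>2\<bar> \<le> 2 * \<eta> / (m * \<sigma>)"
    using pt[of x3 x4] x \<sigma> by auto
  have b: "c \<le> \<xi>1" "\<xi>1 + \<sigma> \<le> \<xi>2" "\<xi>2 \<le> d" using x \<xi>1 \<xi>2 by auto
  note two = derivative_chain_two_points[OF ch \<sigma> b \<xi>1(3) \<xi>2(3)]
  show "\<bar>p0\<bar> \<le> 4 * \<eta> / (m * \<sigma>)\<^sup>2" using two(1) by (simp add: power2_eq_square)
  show p1: "\<bar>p1 y\<bar> \<le> 2 * \<eta> / (m * \<sigma>) * (1 + 2 * Z)" if "c \<le> y" "y \<le> d" for y
    using two(2)[OF that] unfolding Z_def .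
  assume y: "c \<le> y" "y \<le> d"
  have "\<bar>p2 y\<bar> \<le> \<bar>p2 x1\<bar> + 2 * \<eta> / (m * \<sigma>) * (1 + 2 * Z) * M * (d - c)"
    by (rule derivative_chain_growth(2)[OF ch _ _ y p1]) (use x \<sigma> in auto)
  also have "2 * \<eta> / (m * \<sigma>) * (1 + 2 * Z) * M * (d - c) = 2 * \<eta> * (1 + 2 * Z) * Z"
    unfolding Z_def by simp
  finally show "\<bar>p2 y\<bar> \<le> \<eta> * (1 + 2 * Z + 4 * Z\<^sup>2)"
    using x by (simp add: algebra_simps power2_eq_square)
qed

lemma compact_sublevel:
  fixes n :: "real \<Rightarrow> real"
  assumes "continuous_on {c..d} n"
  shows "compact {x\<in>{c..d}. n x \<le> r}"
proof -
  have cl: "closed ({c..d} \<inter> n -` {..r})" using assms by (intro continuous_closed_preimage) auto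
  have eq: "{x\<in>{c..d}. n x \<le> r} = {c..d} \<inter> ({c..d} \<inter> n -` {..r})" by blast
  show ?thesis unfolding eq by (intro compact_Int_closed cl compact_Icc)
qed

text \<open>Interpolation: a larger sublevel set would contain four points 1/3 of the bound apart,
  and smallness there would push all three forms at y below \<rho>. In the language of quantitative
  nondivergence the maximum of the forms is good with exponent 1/2, with a constant independent of
  the weights.\<close>

lemma derivative_chain_sublevel:
  assumes ch: "derivative_chain m M {c..d} p0 p1 p2" "0 < m" "m \<le> M" and cd: "c < d"
    and w: "0 < \<alpha>" "0 < \<beta>" "0 < \<gamma>" and \<rho>: "0 < \<rho>" "0 < \<tau>"
    and y: "y \<in> {c..d}" "\<rho> \<le> max (\<alpha> * \<bar>p0\<bar>) (max (\<beta> * \<bar>p1 y\<bar>) (\<gamma> * \<bar>p2 y\<bar>))"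
  shows "measure lebesgue {x\<in>{c..d}. max (\<alpha> * \<bar>p0\<bar>) (max (\<beta> * \<bar>p1 x\<bar>) (\<gamma> * \<bar>p2 x\<bar>)) \<le> \<tau> * \<rho>}
           \<le> 16 * M / m * sqrt \<tau> * (d - c)" (is "measure lebesgue ?E \<le> ?r")
proof (rule ccontr)
  define E where "E = ?E"
  assume "\<not> measure lebesgue ?E \<le> ?r"
  then have neg: "\<not> measure lebesgue E \<le> ?r" unfolding E_def .
  have cont: "continuous_on {c..d} p1" "continuous_on {c..d} p2"
    using derivative_chain_continuous[OF ch(1)] by auto
  have "continuous_on {c..d} (\<lambda>x. max (\<alpha> * \<bar>p0\<bar>) (max (\<beta> * \<bar>p1 x\<bar>) (\<gamma> * \<bar>p2 x\<bar>)))"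
    using cont by (intro continuous_intros)
  then have E: "compact E" unfolding E_def by (rule compact_sublevel)
  have "E \<subseteq> {c..d}" unfolding E_def by blast
  then have "measure lebesgue E \<le> measure lebesgue {c..d}"
    by (intro measure_mono_fmeasurable fmeasurableD[OF lmeasurable_compact[OF E]] lmeasurable_interval)
  then have le: "measure lebesgue E \<le> d - c" using cd by simp
  define \<sigma> where "\<sigma> = ?r / 3"
  have \<sigma>: "0 < \<sigma>" unfolding \<sigma>_def using ch cd \<rho> by auto
  \<comment> \<open>The set lies in {c..d}, so the bound can fail only if it is less than d - c.
    This leaves the case of small \<tau>.\<close>
  have "16 * (M / m) * sqrt \<tau> < 1"
  proof -
    have "16 * M / m * sqrt \<tau> * (d - c) < 1 * (d - c)" using le neg by (simp only: not_le mult_1)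
    then have "16 * M / m * sqrt \<tau> < 1" using cd by (simp only: mult_less_cancel_right_pos diff_gt_0_iff_gt)
    then show ?thesis by simp
  qed
  moreover have "16 * 1 * sqrt \<tau> \<le> 16 * (M / m) * sqrt \<tau>"
    using ch \<rho> by (intro mult_right_mono mult_left_mono) auto
  ultimately have t16: "sqrt \<tau> < 1 / 16" by linarith
  define r where "r = sqrt \<tau>"
  have r: "0 < r" "r < 1 / 16" "\<tau> = r\<^sup>2" unfolding r_def using t16 \<rho> by auto
  \<comment> \<open>The number 16 is chosen for this: Z = 3 / (16 * r), so the dominant term
    \<open>\<tau> * 4 * Z\<^sup>2\<close> is the constant 9/64 and the whole loss stays below
    1.\<close>
  define Z where "Z = M * (d - c) / (m * \<sigma>)"
  have Z: "Z = 3 / (16 * r)" unfolding Z_def \<sigma>_def r_def[symmetric] using ch cd r by (simp add: field_simps)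
  have Z1: "\<tau> * (1 + 2 * Z + 4 * Z\<^sup>2) = r\<^sup>2 + 3 / 8 * r + 9 / 64"
    unfolding Z r(3) using r(1) by (simp add: field_simps power2_eq_square)
  have "r\<^sup>2 \<le> r" using r by (simp add: power2_eq_square mult_left_le)
  then have Z2: "\<tau> * (1 + 2 * Z + 4 * Z\<^sup>2) < 1" unfolding Z1 using r by linarith
  have "0 \<le> \<tau> * (4 * Z\<^sup>2)" "0 \<le> \<tau> * (2 * Z)" using \<rho> Z r by auto
  then have Z3: "\<tau> * (1 + 2 * Z) < 1" "\<tau> < 1" using Z2 by (auto simp: algebra_simps)
  have "measure lebesgue E > 3 * \<sigma>" unfolding \<sigma>_def using neg by simp
  then obtain x1 x2 x3 x4 where x: "x1 \<in> E" "x2 \<in> E" "x3 \<in> E" "x4 \<in> E"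
    "x1 + \<sigma> \<le> x2" "x2 + \<sigma> \<le> x3" "x3 + \<sigma> \<le> x4"
    by (rule four_separated_points[OF E _ less_imp_le[OF \<sigma>]])
  have bd: "c \<le> x1" "x2 \<le> d" "x4 \<le> d" using x(1,2,4) unfolding E_def by simp_all
  have v1: "\<bar>p1 x\<bar> \<le> \<tau> * \<rho> / \<beta>" and v2: "\<bar>p2 x\<bar> \<le> \<tau> * \<rho> / \<gamma>" if "x \<in> E" for x
  proof -
    have "\<beta> * \<bar>p1 x\<bar> \<le> \<tau> * \<rho>" "\<gamma> * \<bar>p2 x\<bar> \<le> \<tau> * \<rho>" using that unfolding E_def by simp_all
    then show "\<bar>p1 x\<bar> \<le> \<tau> * \<rho> / \<beta>" "\<bar>p2 x\<bar> \<le> \<tau> * \<rho> / \<gamma>"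
      using w by (simp_all add: pos_le_divide_eq mult.commute)
  qed
  have "\<alpha> * \<bar>p0\<bar> \<le> \<tau> * \<rho>" using x(1) unfolding E_def by simp
  also have "\<tau> * \<rho> < \<rho>" using Z3 \<rho> by simp
  finally have a: "\<alpha> * \<bar>p0\<bar> < \<rho>" .
  have yy: "c \<le> y" "y \<le> d" using y by auto
  have "\<bar>p1 y\<bar> \<le> \<tau> * \<rho> / \<beta> * (1 + 2 * Z)"
    unfolding Z_def by (rule derivative_chain_two_points(2)[OF ch \<sigma> bd(1) x(5) bd(2) v1[OF x(1)] v1[OF x(2)] yy])
  then have "\<beta> * \<bar>p1 y\<bar> \<le> \<tau> * (1 + 2 * Z) * \<rho>" using w by (simp add: field_simps)
  also have "\<dots> < \<rho>" using Z3 \<rho> by simp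
  finally have b: "\<beta> * \<bar>p1 y\<bar> < \<rho>" .
  have "\<bar>p2 y\<bar> \<le> \<tau> * \<rho> / \<gamma> * (1 + 2 * Z + 4 * Z\<^sup>2)"
    unfolding Z_def
    by (rule derivative_chain_four_points(3)[OF ch \<sigma> bd(1) x(5-7) bd(3) v2[OF x(1)] v2[OF x(2)] v2[OF x(3)] v2[OF x(4)] yy])
  then have "\<gamma> * \<bar>p2 y\<bar> \<le> \<tau> * (1 + 2 * Z + 4 * Z\<^sup>2) * \<rho>" using w by (simp add: field_simps)
  also have "\<dots> < \<rho>" using Z2 \<rho> by simp
  finally show False using a b y(2) unfolding le_max_iff_disj by linarith
qed

section \<open>Covering an interval by longest subintervals\<close>

lemma measure_Int_split:
  assumes "compact (A :: real set)" "c \<le> d" "d \<le> e"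
  shows "measure lebesgue (A \<inter> {c..e}) \<le> measure lebesgue (A \<inter> {c..d}) + measure lebesgue (A \<inter> {d..e})"
proof -
  have "A \<inter> {c..e} = (A \<inter> {c..d}) \<union> (A \<inter> {d..e})" using assms by auto
  moreover have "compact (A \<inter> {c..d})" "compact (A \<inter> {d..e})"
    using assms(1) by (auto intro: compact_Int_closed)
  ultimately show ?thesis
    by (metis measure_Un_le lmeasurable_compact fmeasurableD)
qed

lemma measure_Int_interval_mono:
  assumes "compact (A :: real set)" "A \<inter> {c..d} \<subseteq> B" "compact B"
  shows "measure lebesgue (A \<inter> {c..d}) \<le> measure lebesgue B"
  using assms by (intro measure_mono_fmeasurable)
    (auto intro: lmeasurable_compact fmeasurableD compact_Int_closed)

text \<open>A supremum replaces the iteration: z is the last point up to which A has density at most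
  \<theta>. No interval of density at most \<theta> can start at z, so if z < t the second
  alternative holds there and contributes the second \<theta> * (t - s).\<close>

lemma right_sweep:
  fixes A :: "real set"
  assumes "compact A" "s \<le> t" "0 \<le> \<theta>"
    and step: "\<And>y. y \<in> A \<Longrightarrow> s \<le> y \<Longrightarrow> y < t \<Longrightarrow>
       (\<exists>d. y < d \<and> d \<le> t \<and> measure lebesgue (A \<inter> {y..d}) \<le> \<theta> * (d - y)) \<or>
       measure lebesgue (A \<inter> {y..t}) \<le> \<theta> * (t - s)"
  shows "measure lebesgue (A \<inter> {s..t}) \<le> 2 * \<theta> * (t - s)"
proof -
  define S where "S = {y\<in>{s..t}. measure lebesgue (A \<inter> {s..y}) \<le> \<theta> * (y - s)}"
  have "measure lebesgue (A \<inter> {s..s}) \<le> measure lebesgue {s..s}"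
    using assms by (intro measure_Int_interval_mono) auto
  then have sS: "s \<in> S" unfolding S_def using assms by simp
  have bdd: "bdd_above S" unfolding S_def by auto
  define z where "z = Sup S"
  have sz: "s \<le> z" unfolding z_def using sS bdd by (rule cSup_upper)
  have zt: "z \<le> t" unfolding z_def using sS by (intro cSup_least) (auto simp: S_def)
  \<comment> \<open>The supremum is attained, since moving the right end point changes the measure
    by at most the distance moved.\<close>
  have zle: "measure lebesgue (A \<inter> {s..z}) \<le> \<theta> * (z - s)"
  proof (rule field_le_epsilon)
    fix e :: real assume e: "0 < e"
    obtain y where y: "y \<in> S" "z - e < y"
      using less_cSupE[of "z - e" S] sS e unfolding z_def by auto
    have yz: "y \<le> z" unfolding z_def using y bdd by (intro cSup_upper)
    have ys: "s \<le> y" using y unfolding S_def by auto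
    have "measure lebesgue (A \<inter> {s..z}) \<le> measure lebesgue (A \<inter> {s..y}) + measure lebesgue (A \<inter> {y..z})"
      using measure_Int_split[OF assms(1) ys yz] .
    also have "measure lebesgue (A \<inter> {y..z}) \<le> measure lebesgue {y..z}"
      using assms by (intro measure_Int_interval_mono) auto
    also have "measure lebesgue {y..z} = z - y" using yz by simp
    also have "measure lebesgue (A \<inter> {s..y}) \<le> \<theta> * (y - s)" using y unfolding S_def by auto
    also have "\<theta> * (y - s) \<le> \<theta> * (z - s)" using yz assms by (intro mult_left_mono) auto
    finally show "measure lebesgue (A \<inter> {s..z}) \<le> \<theta> * (z - s) + e" using y by linarith
  qed
  have beyond: False if d: "z < d" "d \<le> t" "measure lebesgue (A \<inter> {z..d}) \<le> \<theta> * (d - z)" for d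
  proof -
    have "measure lebesgue (A \<inter> {s..d}) \<le> measure lebesgue (A \<inter> {s..z}) + measure lebesgue (A \<inter> {z..d})"
      using measure_Int_split[OF assms(1) sz] d by auto
    also have "\<dots> \<le> \<theta> * (d - s)" using zle d by (simp add: algebra_simps)
    finally have "d \<in> S" unfolding S_def using d sz by auto
    then have "d \<le> z" unfolding z_def using bdd by (rule cSup_upper)
    then show False using d by simp
  qed
  have nonneg: "0 \<le> \<theta> * (t - s)" "0 \<le> \<theta> * (t - z)" using assms zt by auto
  show ?thesis
  proof (cases "z = t")
    case True
    then show ?thesis using zle nonneg by simp
  next
    case False
    then have zt': "z < t" using zt by simp
    show ?thesis
    proof (cases "z \<in> A")
      case True
      then have "measure lebesgue (A \<inter> {z..t}) \<le> \<theta> * (t - s)"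
        using step[OF True sz zt'] beyond by blast
      moreover have "measure lebesgue (A \<inter> {s..t}) \<le> measure lebesgue (A \<inter> {s..z}) + measure lebesgue (A \<inter> {z..t})"
        using measure_Int_split[OF assms(1) sz zt] .
      ultimately show ?thesis using zle nonneg by (simp add: algebra_simps)
    next
      case False
      \<comment> \<open>Outside A a short interval free of A could be appended, against the choice
        of z.\<close>
      have "open (- A)" using assms(1) by (simp add: compact_imp_closed open_Compl)
      then obtain \<delta> where \<delta>: "0 < \<delta>" "ball z \<delta> \<subseteq> - A" using False open_contains_ball by blast
      define d where "d = min t (z + \<delta> / 2)"
      have d: "z < d" "d \<le> t" unfolding d_def using zt' \<delta> by auto
      have "{z..d} \<subseteq> ball z \<delta>" unfolding d_def using \<delta> by (auto simp: dist_real_def)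
      then have "A \<inter> {z..d} = {}" using \<delta> by blast
      then have "measure lebesgue (A \<inter> {z..d}) \<le> \<theta> * (d - z)" using d assms by simp
      then show ?thesis using beyond[OF d] by blast
    qed
  qed
qed

text \<open>Each member has a first point \<open>e i\<close> at which it reaches \<rho>. The member
  for which this point is furthest to the right is still at most \<rho> there, while all others have
  had their turn. Finiteness of F provides the maximum, and \<open>i0\<close> makes the interval
  nondegenerate.\<close>

lemma longest_interval_right:
  fixes n :: "'i \<Rightarrow> real \<Rightarrow> real"
  assumes fin: "finite F" and yt: "y \<le> t"
    and cont: "\<And>i. i \<in> F \<Longrightarrow> continuous_on {y..t} (n i)"
    and low: "i0 \<in> F" "n i0 y < \<rho>"
    and reach: "\<And>i. i \<in> F \<Longrightarrow> \<exists>x\<in>{y..t}. \<rho> \<le> n i x"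
  obtains i d where "i \<in> F" "y < d" "d \<le> t" "\<forall>x\<in>{y..d}. n i x \<le> \<rho>"
    "\<And>j. j \<in> F \<Longrightarrow> \<exists>x\<in>{y..d}. \<rho> \<le> n j x"
proof -
  have "\<exists>e. e \<in> {y..t} \<and> \<rho> \<le> n i e \<and> (\<forall>x\<in>{y..<e}. n i x < \<rho>)" if i: "i \<in> F" for i
  proof -
    have "closed ({y..t} \<inter> n i -` {\<rho>..})"
      using cont[OF i] by (intro continuous_closed_preimage) auto
    then have "compact ({y..t} \<inter> n i -` {\<rho>..})"
      by (metis bounded_Int bounded_closed_interval compact_eq_bounded_closed)
    moreover have "{y..t} \<inter> n i -` {\<rho>..} \<noteq> {}" using reach[OF i] by auto
    ultimately obtain e where e: "e \<in> {y..t} \<inter> n i -` {\<rho>..}"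
        "\<And>x. x \<in> {y..t} \<inter> n i -` {\<rho>..} \<Longrightarrow> e \<le> x"
      using compact_attains_inf by metis
    have "n i x < \<rho>" if "x \<in> {y..<e}" for x
      using e(1) e(2)[of x] that by (cases "n i x < \<rho>") auto
    then show ?thesis using e by auto
  qed
  then obtain e where e: "\<And>i. i \<in> F \<Longrightarrow> e i \<in> {y..t} \<and> \<rho> \<le> n i (e i) \<and> (\<forall>x\<in>{y..<e i}. n i x < \<rho>)"
    by metis
  have ne: "finite (e ` F)" "e ` F \<noteq> {}" using fin low by auto
  obtain i where i: "i \<in> F" "e i = Max (e ` F)" using Max_in[OF ne] by auto
  have le: "e j \<le> e i" if "j \<in> F" for j using Max_ge[OF ne(1)] that i by auto
  have "y \<noteq> e i0" using e[OF low(1)] low(2) by auto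
  then have y: "y < e i" using e[OF low(1)] le[OF low(1)] by auto
  have "continuous_on {y..e i} (n i)" using cont[OF i(1)] e[OF i(1)] by (auto elim: continuous_on_subset)
  then have "n i (e i) \<le> \<rho>"
  proof -
    assume c: "continuous_on {y..e i} (n i)"
    have "closure {y..<e i} = {y..e i}" using y by simp
    then show ?thesis
      using continuous_le_on_closure[of "{y..<e i}" "n i" "e i" \<rho>] c y e[OF i(1)]
      by (simp add: less_imp_le)
  qed
  then have "n i x \<le> \<rho>" if "x \<in> {y..e i}" for x
    using that e[OF i(1)] by (cases "x = e i") (auto intro: less_imp_le)
  moreover have "\<exists>x\<in>{y..e i}. \<rho> \<le> n j x" if "j \<in> F" for j
    using e[OF that] le[OF that] by auto
  ultimately show thesis using that[of i "e i"] i y e[OF i(1)] by auto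
qed

lemma longest_interval_left:
  fixes n :: "'i \<Rightarrow> real \<Rightarrow> real"
  assumes fin: "finite F" and st: "s \<le> t"
    and cont: "\<And>i. i \<in> F \<Longrightarrow> continuous_on {s..t} (n i)"
    and low: "i0 \<in> F" "n i0 t < \<rho>"
    and reach: "\<And>i. i \<in> F \<Longrightarrow> \<exists>x\<in>{s..t}. \<rho> \<le> n i x"
  obtains i c where "i \<in> F" "s \<le> c" "c < t" "\<forall>x\<in>{c..t}. n i x \<le> \<rho>"
    "\<And>j. j \<in> F \<Longrightarrow> \<exists>x\<in>{c..t}. \<rho> \<le> n j x"
proof -
  have c: "continuous_on {- t..- s} (\<lambda>x. n i (- x))" if "i \<in> F" for i
    by (rule continuous_on_compose2[OF cont[OF that]]) (auto intro: continuous_intros)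
  have r: "\<exists>x\<in>{- t..- s}. \<rho> \<le> n i (- x)" if i: "i \<in> F" for i
  proof -
    obtain x where "x \<in> {s..t}" "\<rho> \<le> n i x" using reach[OF i] by blast
    then show ?thesis by (intro bexI[of _ "- x"]) auto
  qed
  obtain i d where id: "i \<in> F" "- t < d" "d \<le> - s" "\<forall>x\<in>{- t..d}. n i (- x) \<le> \<rho>"
    "\<And>j. j \<in> F \<Longrightarrow> \<exists>x\<in>{- t..d}. \<rho> \<le> n j (- x)"
    by (rule longest_interval_right[OF fin _ c low(1) _ r]) (use st low in auto)
  have "n i x \<le> \<rho>" if "x \<in> {- d..t}" for x
    using bspec[OF id(4), of "- x"] that by auto
  moreover have "\<exists>x\<in>{- d..t}. \<rho> \<le> n j x" if "j \<in> F" for j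
  proof -
    obtain x where "x \<in> {- t..d}" "\<rho> \<le> n j (- x)" using id(5)[OF \<open>j \<in> F\<close>] by blast
    then show ?thesis by (intro bexI[of _ "- x"]) auto
  qed
  ultimately show thesis using that[of i "- d"] id by auto
qed

text \<open>Sweep from left to right along the longest intervals on which some member of the family stays
  below the level. The last of them may leave the interval; it is replaced by a longest interval
  ending at the right end point, which accounts for the factor 2.\<close>
lemma measure_by_longest_intervals:
  fixes n :: "'i \<Rightarrow> real \<Rightarrow> real" and A :: "real set"
  assumes fin: "finite F" and st: "s < t" and A: "compact A" "0 \<le> \<theta>"
    and cont: "\<And>i. i \<in> F \<Longrightarrow> continuous_on {s..t} (n i)"
    and reach: "\<And>i. i \<in> F \<Longrightarrow> \<exists>x\<in>{s..t}. \<rho> \<le> n i x"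
    and low: "\<And>x. x \<in> A \<Longrightarrow> s \<le> x \<Longrightarrow> x \<le> t \<Longrightarrow> \<exists>i\<in>F. n i x < \<rho>"
    and local: "\<And>i c d. i \<in> F \<Longrightarrow> s \<le> c \<Longrightarrow> c < d \<Longrightarrow> d \<le> t \<Longrightarrow> \<forall>x\<in>{c..d}. n i x \<le> \<rho> \<Longrightarrow>
       (\<And>j. j \<in> F \<Longrightarrow> \<exists>x\<in>{c..d}. \<rho> \<le> n j x) \<Longrightarrow> measure lebesgue (A \<inter> {c..d}) \<le> \<theta> * (d - c)"
  shows "measure lebesgue (A \<inter> {s..t}) \<le> 2 * \<theta> * (t - s)"
proof (rule right_sweep[OF A(1) less_imp_le[OF st] A(2)])
  fix y assume y: "y \<in> A" "s \<le> y" "y < t"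
  obtain i0 where i0: "i0 \<in> F" "n i0 y < \<rho>" using low[of y] y by auto
  show "(\<exists>d. y < d \<and> d \<le> t \<and> measure lebesgue (A \<inter> {y..d}) \<le> \<theta> * (d - y)) \<or>
       measure lebesgue (A \<inter> {y..t}) \<le> \<theta> * (t - s)"
  proof (cases "\<forall>i\<in>F. \<exists>x\<in>{y..t}. \<rho> \<le> n i x")
    case True
    have c: "continuous_on {y..t} (n i)" if "i \<in> F" for i
      using cont[OF that] y by (auto elim: continuous_on_subset)
    have r: "\<exists>x\<in>{y..t}. \<rho> \<le> n i x" if "i \<in> F" for i using True that by blast
    obtain i d where "i \<in> F" "y < d" "d \<le> t" "\<forall>x\<in>{y..d}. n i x \<le> \<rho>"
      "\<And>j. j \<in> F \<Longrightarrow> \<exists>x\<in>{y..d}. \<rho> \<le> n j x"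
      using longest_interval_right[where n = n and F = F, OF fin less_imp_le[OF y(3)] c i0 r] by metis
    then show ?thesis using local[of i y d] y by blast
  next
    case False
    then obtain j where j: "j \<in> F" "\<And>x. x \<in> {y..t} \<Longrightarrow> n j x < \<rho>" by (auto simp: not_le)
    have jt: "n j t < \<rho>" using j(2) y by auto
    obtain i c where ic: "i \<in> F" "s \<le> c" "c < t" "\<forall>x\<in>{c..t}. n i x \<le> \<rho>"
      "\<And>j. j \<in> F \<Longrightarrow> \<exists>x\<in>{c..t}. \<rho> \<le> n j x"
      using longest_interval_left[where n = n and F = F, OF fin less_imp_le[OF st] cont j(1) jt reach] by metis
    \<comment> \<open>On {y..t} the member j stays below \<rho>, yet it reaches \<rho> on {c..t}; so
      c cannot lie to the right of y.\<close>
    have cy: "c \<le> y"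
    proof -
      obtain x where "x \<in> {c..t}" "\<rho> \<le> n j x" using ic(5)[OF j(1)] by blast
      then show ?thesis using j(2)[of x] by (cases "y \<le> x") auto
    qed
    have "measure lebesgue (A \<inter> {y..t}) \<le> measure lebesgue (A \<inter> {c..t})"
      using cy A(1) by (intro measure_Int_interval_mono) (auto intro: compact_Int_closed)
    also have "\<dots> \<le> \<theta> * (t - c)" using local[OF ic(1-3) order_refl ic(4,5)] .
    also have "\<dots> \<le> \<theta> * (t - s)" using ic A by (intro mult_left_mono) auto
    finally show ?thesis by blast
  qed
qed

section \<open>Integer vectors: pairing, cross product, primitivity\<close>

type_synonym ivec = "int \<times> int \<times> int"

fun idot :: "ivec \<Rightarrow> ivec \<Rightarrow> int" where
  "idot (a, b, c) (x, y, z) = a * x + b * y + c * z"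

fun icross :: "ivec \<Rightarrow> ivec \<Rightarrow> ivec" where
  "icross (a, b, c) (x, y, z) = (b * z - c * y, c * x - a * z, a * y - b * x)"

fun iscale :: "int \<Rightarrow> ivec \<Rightarrow> ivec" where
  "iscale k (a, b, c) = (k * a, k * b, k * c)"

text \<open>By Bezout this says that the coordinates are coprime. The witness z is what the proofs
  use: it recovers the factor of a vector v parallel to w as \<open>idot z v\<close>.\<close>

definition primitive :: "ivec \<Rightarrow> bool" where
  "primitive v \<longleftrightarrow> (\<exists>z. idot z v = 1)"

lemma primitive_nonzero: "primitive v \<Longrightarrow> v \<noteq> (0, 0, 0)"
  unfolding primitive_def by auto

lemma idot_commute: "idot u v = idot v u"
  by (cases u; cases v) simp

text \<open>The triple product expansion z x (v x w) = (z . w) v - (z . v) w, in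
  coordinates.\<close>

lemma icross_double:
  "icross z (icross v w) = (let p = iscale (idot z w) v; q = iscale (idot z v) w in
     (fst p - fst q, fst (snd p) - fst (snd q), snd (snd p) - snd (snd q)))"
  by (cases z; cases v; cases w) (simp add: algebra_simps)

lemma primitive_parallel:
  assumes "primitive w" "icross v w = (0, 0, 0)"
  obtains k where "v = iscale k w"
proof -
  obtain z where z: "idot z w = 1" using assms(1) unfolding primitive_def by blast
  have "v = iscale (idot z v) w"
    using icross_double[of z v w] assms(2) z by (cases z; cases v; cases w) simp
  then show thesis using that by blast
qed

lemma icross_orthogonal: "idot (icross u v) u = 0" "idot (icross u v) v = 0"
  by (cases u; cases v; simp add: algebra_simps)+

lemma iscale_zero: "iscale 0 v = (0, 0, 0)"
  by (cases v) simp

lemma idot_iscale: "idot (iscale k u) v = k * idot u v"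
  by (cases u; cases v) (simp add: algebra_simps)

text \<open>The triple product (u x v) x w is a combination of u and v with coefficients
  \<open>idot u w\<close> and \<open>idot v w\<close> up to sign, hence zero. Geometrically, two
  points on a line w span w, and two lines through a point w meet in w.\<close>

lemma orthogonal_parallel_icross:
  assumes "primitive w" "idot u w = 0" "idot v w = 0"
  obtains k where "icross u v = iscale k w"
proof (rule primitive_parallel[OF assms(1)])
  obtain u1 u2 u3 v1 v2 v3 w1 w2 w3 where uvw: "u = (u1, u2, u3)" "v = (v1, v2, v3)" "w = (w1, w2, w3)"
    by (cases u; cases v; cases w)
  have "u1 * (v1 * w1 + v2 * w2 + v3 * w3) = v1 * (u1 * w1 + u2 * w2 + u3 * w3)"
    "u2 * (v1 * w1 + v2 * w2 + v3 * w3) = v2 * (u1 * w1 + u2 * w2 + u3 * w3)"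
    "u3 * (v1 * w1 + v2 * w2 + v3 * w3) = v3 * (u1 * w1 + u2 * w2 + u3 * w3)"
    using assms(2,3) unfolding uvw idot.simps by simp_all
  then show "icross (icross u v) w = (0, 0, 0)"
    unfolding uvw by (simp add: algebra_simps)
qed (use that in blast)

lemma primitive_multiple:
  assumes "v \<noteq> (0, 0, 0)"
  obtains k w where "primitive w" "v = iscale k w" "k \<noteq> 0"
proof -
  obtain a b c where v: "v = (a, b, c)" by (cases v)
  define g where "g = gcd a (gcd b c)"
  have g: "g \<noteq> 0" unfolding g_def using assms v by auto
  have "g dvd a" "g dvd b" "g dvd c" unfolding g_def by (auto intro: dvd_trans)
  then obtain x y z where xyz: "a = g * x" "b = g * y" "c = g * z" by (auto elim!: dvdE)
  obtain p q where pq: "p * b + q * c = gcd b c" using bezout_int by blast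
  obtain r l where rl: "r * a + l * gcd b c = g" unfolding g_def using bezout_int by blast
  have "g * (r * x + l * p * y + l * q * z) = g * 1"
    using rl pq[symmetric] xyz by (simp add: algebra_simps)
  then have "idot (r, l * p, l * q) (x, y, z) = 1" using g by simp
  then have "primitive (x, y, z)" unfolding primitive_def by blast
  then show thesis using that[of "(x, y, z)" g] xyz v g by simp
qed

section \<open>Quantitative nondivergence for a pair of dual norms\<close>

text \<open>The norms for the two values of \<open>\<sigma>\<close> live on spaces dual to each other under \<open>idot\<close>. Both sides satisfy
  the same assumptions, so that each statement proved for one side holds for the other.\<close>
locale dual_norms =
  fixes n :: "bool \<Rightarrow> ivec \<Rightarrow> real \<Rightarrow> real" and s t C e :: real
  assumes st: "s < t"
    and C: "0 \<le> C"
    and e: "0 < e" "e < 1 / 5"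
    and cont: "continuous_on {s..t} (n \<sigma> v)"
    and nonneg: "0 \<le> n \<sigma> v x"
    and scale: "n \<sigma> (iscale k v) x = real_of_int \<bar>k\<bar> * n \<sigma> v x"
    and cross: "x \<in> {s..t} \<Longrightarrow> n (\<not> \<sigma>) (icross u v) x \<le> 2 * n \<sigma> u x * n \<sigma> v x"
    and dot: "x \<in> {s..t} \<Longrightarrow> real_of_int \<bar>idot u v\<bar> \<le> 3 * n \<sigma> u x * n (\<not> \<sigma>) v x"
    and fin: "finite {v. \<exists>x\<in>{s..t}. n \<sigma> v x \<le> 1}"
    and reach: "v \<noteq> (0, 0, 0) \<Longrightarrow> \<exists>x\<in>{s..t}. 1 / 5 \<le> n \<sigma> v x"
    and good: "s \<le> c \<Longrightarrow> c < d \<Longrightarrow> d \<le> t \<Longrightarrow> y \<in> {c..d} \<Longrightarrow> 1 / 5 \<le> n \<sigma> v y \<Longrightarrow>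
      measure lebesgue {x\<in>{c..d}. n \<sigma> v x \<le> e} \<le> C * (d - c)"
begin

lemma multiple_ge:
  assumes "k \<noteq> 0"
  shows "n \<sigma> v x \<le> n \<sigma> (iscale k v) x"
proof -
  have "1 * n \<sigma> v x \<le> real_of_int \<bar>k\<bar> * n \<sigma> v x"
    using assms by (intro mult_right_mono nonneg) linarith
  then show ?thesis by (simp add: scale)
qed

text \<open>The cutoff 1 makes the family finite, as longest intervals require, and discards nothing
  that matters, since only norms at most e < 1 count. Primitive vectors suffice because a nonzero
  integer multiple is never shorter.\<close>

definition family :: "(bool \<times> ivec) set" where
  "family = {(\<sigma>, v). primitive v \<and> (\<exists>x\<in>{s..t}. n \<sigma> v x \<le> 1)}"

definition short_set :: "real set" where
  "short_set = {x\<in>{s..t}. \<exists>(\<sigma>, v)\<in>family. n \<sigma> v x \<le> e}"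

lemma finite_family: "finite family"
proof (rule finite_subset)
  show "family \<subseteq> (SIGMA \<sigma>:UNIV. {v. \<exists>x\<in>{s..t}. n \<sigma> v x \<le> 1})" unfolding family_def by auto
qed (intro finite_SigmaI fin finite)

lemma primitive_in_family:
  "primitive v \<Longrightarrow> x \<in> {s..t} \<Longrightarrow> n \<sigma> v x \<le> e \<Longrightarrow> (\<sigma>, v) \<in> family"
  unfolding family_def using e by force

lemma compact_sublevel_n:
  assumes "s \<le> c" "d \<le> t"
  shows "compact {x\<in>{c..d}. n \<sigma> v x \<le> r}"
  by (rule compact_sublevel, rule continuous_on_subset[OF cont]) (use assms in auto)

lemma compact_short_set: "compact short_set"
proof -
  have "short_set = (\<Union>(\<sigma>, v)\<in>family. {x\<in>{s..t}. n \<sigma> v x \<le> e})"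
    unfolding short_set_def by auto
  then show ?thesis using compact_sublevel_n[of s t]
    by (auto intro!: compact_UN finite_family)
qed

lemma nonzero_in_short_set:
  assumes "v \<noteq> (0, 0, 0)" "x \<in> {s..t}" "n \<sigma> v x \<le> e"
  shows "x \<in> short_set"
proof -
  obtain k w where w: "primitive w" "v = iscale k w" "k \<noteq> 0"
    using primitive_multiple[OF assms(1)] .
  have "n \<sigma> w x \<le> e" using multiple_ge[OF w(3), of \<sigma> w x] assms(3) w by simp
  then show ?thesis using primitive_in_family[OF w(1) assms(2)] assms(2) unfolding short_set_def by auto
qed

text \<open>Two independent vectors that are short at the same point span a dual vector that is
  short as well, and vectors of opposite sides that are short at the same point are orthogonal.
  So near a short u everything short is governed by the dual vectors orthogonal to u, and among
  those two different short ones would make u shorter than e.\<close>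
lemma short_set_near_short_vector:
  assumes u: "(\<sigma>, u) \<in> family" and cd: "s \<le> c" "c < d" "d \<le> t"
    and le: "\<forall>x\<in>{c..d}. n \<sigma> u x \<le> 1 / 5"
    and far: "\<And>\<sigma> v. (\<sigma>, v) \<in> family \<Longrightarrow> \<exists>x\<in>{c..d}. 1 / 5 \<le> n \<sigma> v x"
  shows "measure lebesgue (short_set \<inter> {c..d}) \<le> 3 * C * (d - c)"
proof -
  have pu: "primitive u" using u unfolding family_def by auto
  define W where "W = {w. (\<not> \<sigma>, w) \<in> family \<and> idot w u = 0}"
  have "Pair (\<not> \<sigma>) ` W \<subseteq> family" unfolding W_def by auto
  then have finW: "finite W"
    by (meson finite_family finite_imageD finite_subset inj_onI prod.inject)
  \<comment> \<open>The bound on u is not strict, so that B is compact; its overlap with E does no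
    harm.\<close>
  define B where "B = {x\<in>{c..d}. e \<le> n \<sigma> u x \<and> (\<exists>w\<in>W. n (\<not> \<sigma>) w x \<le> e)}"
  define E where "E = {x\<in>{c..d}. n \<sigma> u x \<le> e}"
  have pW: "primitive w" "idot w u = 0" "w \<in> W \<Longrightarrow> (\<not> \<sigma>, w) \<in> family" if "w \<in> W" for w
    using that unfolding W_def family_def by auto
  have sub: "short_set \<inter> {c..d} \<subseteq> E \<union> B"
  proof
    fix x assume x: "x \<in> short_set \<inter> {c..d}"
    then have xst: "x \<in> {s..t}" and xcd: "x \<in> {c..d}" using cd by auto
    obtain \<tau> v where v: "(\<tau>, v) \<in> family" "n \<tau> v x \<le> e" using x unfolding short_set_def by auto
    have pv: "primitive v" using v unfolding family_def by auto
    have lu: "n \<sigma> u x \<le> 1 / 5" using le xcd by auto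
    have W: "x \<in> B" if w: "primitive w" "idot w u = 0" "n (\<not> \<sigma>) w x \<le> e" "e < n \<sigma> u x" for w
    proof -
      have "w \<in> W" unfolding W_def using primitive_in_family[OF w(1) xst w(3)] w(2) by simp
      then show ?thesis unfolding B_def using w(3,4) xcd by (blast intro: less_imp_le)
    qed
    show "x \<in> E \<union> B"
    proof (cases "n \<sigma> u x \<le> e")
      case True
      then show ?thesis unfolding E_def using xcd by auto
    next
      case False
      \<comment> \<open>The level 1/5 serves both cases: twice this product is at most e, which
        makes the cross product short, and three times it is below 1, which makes the integer
        \<open>idot u v\<close> vanish.\<close>
      have prod: "n \<tau> v x * n \<sigma> u x \<le> e * (1 / 5)" using v(2) lu nonneg e by (intro mult_mono) auto
      show ?thesis
      proof (cases "\<tau> = \<sigma>")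
        case True
        have nz: "icross v u \<noteq> (0, 0, 0)"
        proof
          assume "icross v u = (0, 0, 0)"
          then obtain k where k: "v = iscale k u" using primitive_parallel[OF pu] by metis
          then have "k \<noteq> 0" using primitive_nonzero[OF pv] iscale_zero[of u] by auto
          then show False using multiple_ge[of k \<sigma> u x] k v(2) True False by simp
        qed
        obtain k w where w: "primitive w" "icross v u = iscale k w" "k \<noteq> 0"
          using primitive_multiple[OF nz] .
        have "n (\<not> \<sigma>) w x \<le> n (\<not> \<sigma>) (icross v u) x" using multiple_ge[OF w(3)] w(2) by simp
        also have "\<dots> \<le> 2 * n \<sigma> v x * n \<sigma> u x" using cross[OF xst] .
        also have "\<dots> \<le> e" using prod e unfolding True by simp
        finally have "n (\<not> \<sigma>) w x \<le> e" .
        moreover have "k * idot w u = 0"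
          using icross_orthogonal(2)[of v u] w(2) idot_iscale[of k w u] by simp
        ultimately show ?thesis using W[OF w(1)] w(3) False by simp
      next
        case neq: False
        then have \<tau>: "\<tau> = (\<not> \<sigma>)" by auto
        have "real_of_int \<bar>idot u v\<bar> \<le> 3 * n \<sigma> u x * n (\<not> \<sigma>) v x" using dot[OF xst] .
        also have "\<dots> \<le> 3 * (e * (1 / 5))" using prod unfolding \<tau> by (simp add: mult.commute)
        also have "\<dots> < 1" using e by simp
        finally have "idot u v = 0" by linarith
        then show ?thesis using W[OF pv] v(2) False unfolding \<tau> by (simp add: idot_commute)
      qed
    qed
  qed
  have E: "compact E" unfolding E_def by (rule compact_sublevel_n[OF cd(1,3)])
  have B: "compact B"
  proof -
    have "B = (\<Union>w\<in>W. {x\<in>{c..d}. max (e - n \<sigma> u x) (n (\<not> \<sigma>) w x - e) \<le> 0})"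
      unfolding B_def by auto
    moreover have "compact {x\<in>{c..d}. max (e - n \<sigma> u x) (n (\<not> \<sigma>) w x - e) \<le> 0}" for w
    proof (rule compact_sublevel)
      have "continuous_on {c..d} (n \<sigma> v)" for \<sigma> v
        by (rule continuous_on_subset[OF cont]) (use cd in auto)
      then show "continuous_on {c..d} (\<lambda>x. max (e - n \<sigma> u x) (n (\<not> \<sigma>) w x - e))"
        by (intro continuous_intros)
    qed
    ultimately show ?thesis by (auto intro!: compact_UN finW)
  qed
  have "measure lebesgue E \<le> C * (d - c)"
    using far[OF u] good[OF cd] unfolding E_def by blast
  \<comment> \<open>The second round: a sweep over the companions of u alone, with density C on each
    piece.\<close>
  moreover have "measure lebesgue (B \<inter> {c..d}) \<le> 2 * C * (d - c)"
  proof (rule measure_by_longest_intervals[OF finW cd(2) B C, where n = "n (\<not> \<sigma>)" and \<rho> = "1 / 5"])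
    show "continuous_on {c..d} (n (\<not> \<sigma>) w)" for w
      by (rule continuous_on_subset[OF cont]) (use cd in auto)
    show "\<exists>x\<in>{c..d}. 1 / 5 \<le> n (\<not> \<sigma>) w x" if "w \<in> W" for w using far pW(3)[OF that that] .
    show "\<exists>w\<in>W. n (\<not> \<sigma>) w x < 1 / 5" if "x \<in> B" for x
      using that e unfolding B_def by force
    fix w a b
    assume w: "w \<in> W" and ab: "c \<le> a" "a < b" "b \<le> d"
      and lw: "\<forall>x\<in>{a..b}. n (\<not> \<sigma>) w x \<le> 1 / 5"
      and fw: "\<And>j. j \<in> W \<Longrightarrow> \<exists>x\<in>{a..b}. 1 / 5 \<le> n (\<not> \<sigma>) j x"
    have "B \<inter> {a..b} \<subseteq> {x\<in>{a..b}. n (\<not> \<sigma>) w x \<le> e}"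
    proof
      fix x assume x: "x \<in> B \<inter> {a..b}"
      then have xst: "x \<in> {s..t}" using cd ab by auto
      obtain v where v: "v \<in> W" "n (\<not> \<sigma>) v x \<le> e" and ux: "e \<le> n \<sigma> u x"
        using x unfolding B_def by auto
      obtain k where k: "icross v w = iscale k u"
        using orthogonal_parallel_icross[OF pu pW(2)[OF v(1)] pW(2)[OF w]] by metis
      \<comment> \<open>Otherwise u, up to a nonzero multiple the cross product of v and w, would
        have norm at most 2/5 * e at x, contrary to the lower bound built into B. So every short
        companion is parallel to w, and the estimate for the single vector w covers them
        all.\<close>
      have "k = 0"
      proof (rule ccontr)
        assume "k \<noteq> 0"
        then have "n \<sigma> u x \<le> n \<sigma> (icross v w) x" using multiple_ge k by simp
        also have "\<dots> \<le> 2 * n (\<not> \<sigma>) v x * n (\<not> \<sigma>) w x" using cross[OF xst, of "\<not> \<sigma>"] by simp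
        also have "\<dots> \<le> 2 * (e * (1 / 5))"
          using mult_mono[OF v(2), of "n (\<not> \<sigma>) w x" "1 / 5"] lw x nonneg e by auto
        finally show False using ux e by simp
      qed
      then have "icross v w = (0, 0, 0)" using k iscale_zero by simp
      then obtain l where l: "v = iscale l w" using primitive_parallel[OF pW(1)[OF w]] by metis
      then have "l \<noteq> 0" using primitive_nonzero[OF pW(1)[OF v(1)]] iscale_zero[of w] by auto
      then show "x \<in> {x\<in>{a..b}. n (\<not> \<sigma>) w x \<le> e}"
        using multiple_ge[of l "\<not> \<sigma>" w x] l v(2) x by auto
    qed
    then have "measure lebesgue (B \<inter> {a..b}) \<le> measure lebesgue {x\<in>{a..b}. n (\<not> \<sigma>) w x \<le> e}"
      using ab cd by (intro measure_Int_interval_mono[OF B] compact_sublevel_n) auto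
    also have "\<dots> \<le> C * (b - a)"
    proof -
      have "s \<le> a" "b \<le> t" using ab cd by auto
      then show ?thesis using fw[OF w] good[of a b _ "\<not> \<sigma>" w] ab(2) by blast
    qed
    finally show "measure lebesgue (B \<inter> {a..b}) \<le> C * (b - a)" .
  qed
  moreover have "B \<inter> {c..d} = B" unfolding B_def by auto
  moreover have "measure lebesgue (short_set \<inter> {c..d}) \<le> measure lebesgue (E \<union> B)"
    using sub by (intro measure_Int_interval_mono compact_short_set) (auto intro: E B compact_Un)
  moreover have "measure lebesgue (E \<union> B) \<le> measure lebesgue E + measure lebesgue B"
    by (intro measure_Un_le fmeasurableD lmeasurable_compact E B)
  ultimately show ?thesis by simp
qed

text \<open>The first round, over points and lines together: density 3 * C near each longest-lasting
  vector, doubled by the sweep.\<close>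

lemma measure_short_set: "measure lebesgue short_set \<le> 6 * C * (t - s)"
proof -
  have "measure lebesgue (short_set \<inter> {s..t}) \<le> 2 * (3 * C) * (t - s)"
  proof (rule measure_by_longest_intervals[OF finite_family st compact_short_set,
        where n = "\<lambda>(\<sigma>, v). n \<sigma> v" and \<rho> = "1 / 5"])
    show "continuous_on {s..t} (case i of (\<sigma>, v) \<Rightarrow> n \<sigma> v)" for i
      by (cases i) (simp add: cont)
    show "\<exists>x\<in>{s..t}. 1 / 5 \<le> (case i of (\<sigma>, v) \<Rightarrow> n \<sigma> v) x" if "i \<in> family" for i
      using that reach primitive_nonzero unfolding family_def by (cases i) auto
    show "\<exists>i\<in>family. (case i of (\<sigma>, v) \<Rightarrow> n \<sigma> v) x < 1 / 5" if "x \<in> short_set" for x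
      using that e unfolding short_set_def by force
    fix i c d
    assume "i \<in> family" "s \<le> c" "c < d" "d \<le> t" "\<forall>x\<in>{c..d}. (case i of (\<sigma>, v) \<Rightarrow> n \<sigma> v) x \<le> 1 / 5"
      "\<And>j. j \<in> family \<Longrightarrow> \<exists>x\<in>{c..d}. 1 / 5 \<le> (case j of (\<sigma>, v) \<Rightarrow> n \<sigma> v) x"
    then show "measure lebesgue (short_set \<inter> {c..d}) \<le> 3 * C * (d - c)"
      using short_set_near_short_vector[of "fst i" "snd i" c d] by (cases i) force
  qed (use C in auto)
  moreover have "short_set \<inter> {s..t} = short_set" unfolding short_set_def by auto
  ultimately show ?thesis by simp
qed

end

section \<open>Points and lines relative to the curve\<close>

text \<open>Meant for forms with integer coefficients: \<open>p0\<close> is an integer, so it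
  vanishes; then \<open>p1 s\<close> is an integer and vanishes, and then \<open>p2 s\<close>. In
  this way a vector that is too short on the whole interval is zero. The four points used are
  equally spaced and include both ends.\<close>

lemma derivative_chain_small:
  assumes ch: "derivative_chain m M {s..t} p0 p1 p2" "0 < m" "m \<le> M" and st: "s < t"
    and small: "\<And>x. x \<in> {s..t} \<Longrightarrow> \<bar>p2 x\<bar> \<le> \<eta>"
    and \<eta>: "\<eta> * (4 / (m * ((t - s) / 3))\<^sup>2 + 2 / (m * ((t - s) / 3)) * (1 + 6 * M / m) + 1) < 1"
  shows "\<bar>p0\<bar> < 1" "\<bar>p1 s\<bar> < 1" "\<bar>p2 s\<bar> < 1"
proof -
  define \<sigma> where "\<sigma> = (t - s) / 3"
  have \<sigma>: "0 < \<sigma>" "t - s = 3 * \<sigma>" unfolding \<sigma>_def using st by auto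
  have Z: "M * (t - s) / (m * \<sigma>) = 3 * M / m" using \<sigma> by simp
  have x: "s \<le> s" "s + \<sigma> \<le> s + \<sigma>" "s + \<sigma> + \<sigma> \<le> s + 2 * \<sigma>" "s + 2 * \<sigma> + \<sigma> \<le> t" "t \<le> t"
    using \<sigma> by auto
  have in_st: "s \<in> {s..t}" "s + \<sigma> \<in> {s..t}" "s + 2 * \<sigma> \<in> {s..t}" "t \<in> {s..t}" using \<sigma> by auto
  note four = derivative_chain_four_points[OF ch \<sigma>(1) x small[OF in_st(1)] small[OF in_st(2)] small[OF in_st(3)] small[OF in_st(4)]]
  have \<eta>0: "0 \<le> \<eta>" using small[of s] st by simp
  have nn: "0 \<le> \<eta> * (4 / (m * \<sigma>)\<^sup>2)" "0 \<le> \<eta> * (2 / (m * \<sigma>) * (1 + 6 * M / m))"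
    using \<eta>0 ch \<sigma> by auto
  have sum: "\<eta> * (4 / (m * \<sigma>)\<^sup>2) + \<eta> * (2 / (m * \<sigma>) * (1 + 6 * M / m)) + \<eta> < 1"
    using \<eta> unfolding \<sigma>_def by (simp add: algebra_simps)
  have "\<bar>p0\<bar> \<le> \<eta> * (4 / (m * \<sigma>)\<^sup>2)" using four(1) \<sigma> by (simp add: mult.commute)
  then show "\<bar>p0\<bar> < 1" using sum nn \<eta>0 by linarith
  have "2 * \<eta> / (m * \<sigma>) * (1 + 2 * (3 * M / m)) = \<eta> * (2 / (m * \<sigma>) * (1 + 6 * M / m))" by simp
  moreover have "\<bar>p1 s\<bar> \<le> 2 * \<eta> / (m * \<sigma>) * (1 + 2 * (3 * M / m))" using four(2)[of s] st unfolding Z by simp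
  ultimately have "\<bar>p1 s\<bar> \<le> \<eta> * (2 / (m * \<sigma>) * (1 + 6 * M / m))" by (simp only:)
  then show "\<bar>p1 s\<bar> < 1" using sum nn \<eta>0 by linarith
  have "\<bar>p2 s\<bar> \<le> \<eta>" using small[of s] st by simp
  then show "\<bar>p2 s\<bar> < 1" using sum nn by linarith
qed

text \<open>The source of the factor 2 in \<open>cross\<close>: a 2 by 2 minor is a sum of two
  products, and its weight is the product of the weights of its rows.\<close>

lemma abs_minor_le:
  fixes p q :: real
  assumes "0 \<le> p" "0 \<le> q" "p * \<bar>a\<bar> \<le> A" "q * \<bar>b\<bar> \<le> A" "p * \<bar>a'\<bar> \<le> A'" "q * \<bar>b'\<bar> \<le> A'"
  shows "p * q * \<bar>a * b' - b * a'\<bar> \<le> 2 * A * A'"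
proof -
  have "p * q * \<bar>a * b' - b * a'\<bar> \<le> p * q * (\<bar>a\<bar> * \<bar>b'\<bar> + \<bar>b\<bar> * \<bar>a'\<bar>)"
    using assms by (intro mult_left_mono) (auto simp: abs_mult[symmetric])
  also have "\<dots> = (p * \<bar>a\<bar>) * (q * \<bar>b'\<bar>) + (q * \<bar>b\<bar>) * (p * \<bar>a'\<bar>)" by (simp add: algebra_simps)
  also have "\<dots> \<le> A * A' + A * A'"
  proof -
    have nn: "0 \<le> p * \<bar>a\<bar>" "0 \<le> q * \<bar>b\<bar>" "0 \<le> p * \<bar>a'\<bar>" "0 \<le> q * \<bar>b'\<bar>" using assms(1,2) by simp_all
    then have "0 \<le> A" using assms(3) by linarith
    then show ?thesis using nn assms(3-6) by (intro add_mono mult_mono)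
  qed
  finally show ?thesis by simp
qed

lemma finite_ivec_box: "finite {(a :: int, b :: int, c :: int). \<bar>real_of_int a\<bar> \<le> K \<and> \<bar>real_of_int b\<bar> \<le> K \<and> \<bar>real_of_int c\<bar> \<le> K}"
proof (rule finite_subset)
  let ?I = "{- \<lceil>K\<rceil>..\<lceil>K\<rceil>}"
  have "x \<in> ?I" if "\<bar>real_of_int x\<bar> \<le> K" for x using that by (auto simp: abs_le_iff) linarith+
  then show "{(a :: int, b :: int, c :: int). \<bar>real_of_int a\<bar> \<le> K \<and> \<bar>real_of_int b\<bar> \<le> K \<and> \<bar>real_of_int c\<bar> \<le> K}
    \<subseteq> ?I \<times> ?I \<times> ?I" by auto
qed auto

locale curve =
  fixes f f1 f2 :: "real \<Rightarrow> real" and s t m M :: real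
  assumes st: "s < t" and mM: "0 < m" "m \<le> 1" "1 \<le> M"
    and f: "x \<in> {s..t} \<Longrightarrow> (f has_real_derivative f1 x) (at x)"
    and f1: "x \<in> {s..t} \<Longrightarrow> (f1 has_real_derivative f2 x) (at x)"
    and f2: "x \<in> {s..t} \<Longrightarrow> m \<le> \<bar>f2 x\<bar>" "x \<in> {s..t} \<Longrightarrow> \<bar>f2 x\<bar> \<le> M"
begin

text \<open>A point (p/q, r/q) is encoded as (q, p, r), a line a + b x + c y = 0 as (a, b, c). The forms
  below measure the position of the point relative to the tangent of the graph at x, and the
  value and slope at x of the line along the graph.\<close>

definition point_off :: "ivec \<Rightarrow> real \<Rightarrow> real" where
  "point_off = (\<lambda>(q, p, r) x. q * x - p)"

definition point_tan :: "ivec \<Rightarrow> real \<Rightarrow> real" where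
  "point_tan = (\<lambda>(q, p, r) x. q * f x - f1 x * (q * x - p) - r)"

definition line_val :: "ivec \<Rightarrow> real \<Rightarrow> real" where
  "line_val = (\<lambda>(a, b, c) x. a + b * x + c * f x)"

definition line_slope :: "ivec \<Rightarrow> real \<Rightarrow> real" where
  "line_slope = (\<lambda>(a, b, c) x. b + c * f1 x)"

lemmas form_defs = point_off_def point_tan_def line_val_def line_slope_def

text \<open>The tangent term in \<open>point_tan\<close> is there for this: on differentiation q *
  f1 x cancels and only - f2 x * (q * x - p) remains.\<close>

lemma point_chain: "derivative_chain m M {s..t} (real_of_int (fst v)) (point_off v) (point_tan v)"
  unfolding derivative_chain_def
proof (intro exI ballI conjI)
  fix x assume x: "x \<in> {s..t}"
  obtain q p r where v: "v = (q, p, r)" by (cases v)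
  show "(point_off v has_real_derivative real_of_int (fst v) * (\<lambda>_. 1) x) (at x)"
    unfolding v form_defs by (auto intro!: derivative_eq_intros)
  show "(point_tan v has_real_derivative point_off v x * (\<lambda>x. - f2 x) x) (at x)"
    unfolding v form_defs by (auto intro!: derivative_eq_intros f[OF x] f1[OF x] simp: algebra_simps)
  show "m \<le> \<bar>1\<bar>" "\<bar>1\<bar> \<le> M" "m \<le> \<bar>- f2 x\<bar>" "\<bar>- f2 x\<bar> \<le> M" using mM f2[OF x] by auto
qed

lemma line_chain: "derivative_chain m M {s..t} (real_of_int (snd (snd v))) (line_slope v) (line_val v)"
  unfolding derivative_chain_def
proof (intro exI ballI conjI)
  fix x assume x: "x \<in> {s..t}"
  obtain a b c where v: "v = (a, b, c)" by (cases v)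
  show "(line_slope v has_real_derivative real_of_int (snd (snd v)) * f2 x) (at x)"
    unfolding v form_defs by (auto intro!: derivative_eq_intros f1[OF x])
  show "(line_val v has_real_derivative line_slope v x * (\<lambda>_. 1) x) (at x)"
    unfolding v form_defs by (auto intro!: derivative_eq_intros f[OF x])
  show "m \<le> \<bar>1\<bar>" "\<bar>1\<bar> \<le> M" "m \<le> \<bar>f2 x\<bar>" "\<bar>f2 x\<bar> \<le> M" using mM f2[OF x] by auto
qed

lemma bounded_on_curve:
  "\<exists>B\<ge>0. \<forall>x\<in>{s..t}. \<bar>x\<bar> \<le> B \<and> \<bar>f x\<bar> \<le> B \<and> \<bar>f1 x\<bar> \<le> B"
proof -
  have "continuous_on {s..t} f" "continuous_on {s..t} f1"
    using f f1 by (meson DERIV_isCont continuous_at_imp_continuous_on)+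
  then have "compact (f ` {s..t})" "compact (f1 ` {s..t})" by (auto intro: compact_continuous_image)
  then obtain B1 B2 where "\<forall>y\<in>f ` {s..t}. norm y \<le> B1" "\<forall>y\<in>f1 ` {s..t}. norm y \<le> B2"
    using compact_imp_bounded bounded_iff by metis
  then have "\<bar>x\<bar> \<le> max (\<bar>s\<bar> + \<bar>t\<bar>) (max B1 B2) \<and> \<bar>f x\<bar> \<le> max (\<bar>s\<bar> + \<bar>t\<bar>) (max B1 B2) \<and>
      \<bar>f1 x\<bar> \<le> max (\<bar>s\<bar> + \<bar>t\<bar>) (max B1 B2)" if "x \<in> {s..t}" for x
    using that by (auto simp: le_max_iff_disj)
  moreover have "0 \<le> max (\<bar>s\<bar> + \<bar>t\<bar>) (max B1 B2)" by (simp add: le_max_iff_disj)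
  ultimately show ?thesis by blast
qed

text \<open>The coefficient of \<eta> in \<open>derivative_chain_small\<close>, that is, the sum of
  the bounds for the three forms per unit bound on the last one.\<close>

definition reach_const :: real where
  "reach_const = 4 / (m * ((t - s) / 3))\<^sup>2 + 2 / (m * ((t - s) / 3)) * (1 + 6 * M / m) + 1"

lemma reach_const_ge: "1 \<le> reach_const"
  unfolding reach_const_def using st mM by (auto intro!: add_nonneg_nonneg mult_nonneg_nonneg)

end

section \<open>Weighted norms on points and lines, and their duality\<close>

text \<open>Weights of product 1 are a unimodular rescaling, which makes the norms of points and
  lines dual up to constants. The two conditions in \<open>large\<close> concern the weights
  \<gamma> and \<beta> * \<gamma> of the last forms of points and of lines; they force every nonzero
  vector to reach the level 1/5.\<close>

locale weighted_curve = curve +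
  fixes \<alpha> \<beta> \<gamma> e :: real
  assumes pos: "0 < \<alpha>" "0 < \<beta>" "0 < \<gamma>" and unit: "\<alpha> * \<beta> * \<gamma> = 1"
    and e: "0 < e" "e < 1 / 5"
    and large: "reach_const < 5 * \<gamma>" "reach_const < 5 * (\<beta> * \<gamma>)"
begin

definition point_norm :: "ivec \<Rightarrow> real \<Rightarrow> real" where
  "point_norm v x = max (\<alpha> * \<bar>real_of_int (fst v)\<bar>) (max (\<beta> * \<bar>point_off v x\<bar>) (\<gamma> * \<bar>point_tan v x\<bar>))"

text \<open>The forms of a line through two points are minors, hence the pairwise products as
  weights. Each is the reciprocal of the missing weight.\<close>

definition line_norm :: "ivec \<Rightarrow> real \<Rightarrow> real" where
  "line_norm v x = max (\<alpha> * \<beta> * \<bar>real_of_int (snd (snd v))\<bar>)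
     (max (\<alpha> * \<gamma> * \<bar>line_slope v x\<bar>) (\<beta> * \<gamma> * \<bar>line_val v x\<bar>))"

lemma point_norm_ge:
  "\<alpha> * \<bar>real_of_int (fst v)\<bar> \<le> point_norm v x" "\<beta> * \<bar>point_off v x\<bar> \<le> point_norm v x"
  "\<gamma> * \<bar>point_tan v x\<bar> \<le> point_norm v x"
  unfolding point_norm_def by simp_all

lemma line_norm_ge:
  "\<alpha> * \<beta> * \<bar>real_of_int (snd (snd v))\<bar> \<le> line_norm v x" "\<alpha> * \<gamma> * \<bar>line_slope v x\<bar> \<le> line_norm v x"
  "\<beta> * \<gamma> * \<bar>line_val v x\<bar> \<le> line_norm v x"
  unfolding line_norm_def by simp_all

lemma norms_scale:
  "point_norm (iscale k v) x = real_of_int \<bar>k\<bar> * point_norm v x"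
  "line_norm (iscale k v) x = real_of_int \<bar>k\<bar> * line_norm v x"
proof -
  obtain a b c where v: "v = (a, b, c)" by (cases v)
  have "point_off (iscale k v) x = k * point_off v x" "point_tan (iscale k v) x = k * point_tan v x"
    "line_slope (iscale k v) x = k * line_slope v x" "line_val (iscale k v) x = k * line_val v x"
    "fst (iscale k v) = k * fst v" "snd (snd (iscale k v)) = k * snd (snd v)"
    unfolding v form_defs by (simp_all add: algebra_simps)
  then show "point_norm (iscale k v) x = real_of_int \<bar>k\<bar> * point_norm v x"
    "line_norm (iscale k v) x = real_of_int \<bar>k\<bar> * line_norm v x"
    unfolding point_norm_def line_norm_def
    by (simp_all add: abs_mult max_mult_distrib_left mult.left_commute mult.commute)
qed

text \<open>The cross product of two points is the line through them, and its forms at x are the 2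
  by 2 minors of the forms of the points, up to sign.\<close>

lemma line_norm_icross: "line_norm (icross u v) x \<le> 2 * point_norm u x * point_norm v x"
proof -
  obtain q p r q' p' r' where uv: "u = (q, p, r)" "v = (q', p', r')" by (cases u; cases v)
  have 1: "real_of_int (snd (snd (icross u v))) = point_off u x * fst v - fst u * point_off v x"
    "line_slope (icross u v) x = fst u * point_tan v x - point_tan u x * fst v"
    "line_val (icross u v) x = point_off u x * point_tan v x - point_tan u x * point_off v x"
    unfolding uv form_defs by (simp_all add: algebra_simps)
  have w: "\<beta> * \<alpha> = \<alpha> * \<beta>" by simp
  note nn = less_imp_le[OF pos(1)] less_imp_le[OF pos(2)] less_imp_le[OF pos(3)]
  show ?thesis
    unfolding line_norm_def 1 max.bounded_iff
    using abs_minor_le[OF nn(2,1) point_norm_ge(2)[of u] point_norm_ge(1)[of u] point_norm_ge(2)[of v] point_norm_ge(1)[of v]]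
      abs_minor_le[OF nn(1,3) point_norm_ge(1)[of u] point_norm_ge(3)[of u] point_norm_ge(1)[of v] point_norm_ge(3)[of v]]
      abs_minor_le[OF nn(2,3) point_norm_ge(2)[of u] point_norm_ge(3)[of u] point_norm_ge(2)[of v] point_norm_ge(3)[of v]]
    unfolding w by blast
qed

text \<open>Dually, two lines span their common point. Here \<alpha> * \<beta> * \<gamma> = 1 turns
  products of line weights back into point weights.\<close>

lemma point_norm_icross: "point_norm (icross u v) x \<le> 2 * line_norm u x * line_norm v x"
proof -
  obtain q p r q' p' r' where uv: "u = (q, p, r)" "v = (q', p', r')" by (cases u; cases v)
  have 1: "real_of_int (fst (icross u v)) = line_slope u x * snd (snd v) - snd (snd u) * line_slope v x"
    "point_off (icross u v) x = line_val u x * snd (snd v) - snd (snd u) * line_val v x"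
    "point_tan (icross u v) x = line_slope u x * line_val v x - line_val u x * line_slope v x"
    unfolding uv form_defs by (simp_all add: algebra_simps)
  have "(\<alpha> * \<gamma>) * (\<alpha> * \<beta>) = \<alpha> * (\<alpha> * \<beta> * \<gamma>)" "(\<beta> * \<gamma>) * (\<alpha> * \<beta>) = \<beta> * (\<alpha> * \<beta> * \<gamma>)"
    "(\<alpha> * \<gamma>) * (\<beta> * \<gamma>) = \<gamma> * (\<alpha> * \<beta> * \<gamma>)" by simp_all
  then have w: "(\<alpha> * \<gamma>) * (\<alpha> * \<beta>) = \<alpha>" "(\<beta> * \<gamma>) * (\<alpha> * \<beta>) = \<beta>" "(\<alpha> * \<gamma>) * (\<beta> * \<gamma>) = \<gamma>"
    unfolding unit by simp_all
  have nn: "0 \<le> \<alpha> * \<beta>" "0 \<le> \<alpha> * \<gamma>" "0 \<le> \<beta> * \<gamma>" using pos by simp_all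
  show ?thesis
    unfolding point_norm_def 1 max.bounded_iff
    using abs_minor_le[OF nn(2,1) line_norm_ge(2)[of u] line_norm_ge(1)[of u] line_norm_ge(2)[of v] line_norm_ge(1)[of v]]
      abs_minor_le[OF nn(3,1) line_norm_ge(3)[of u] line_norm_ge(1)[of u] line_norm_ge(3)[of v] line_norm_ge(1)[of v]]
      abs_minor_le[OF nn(2,3) line_norm_ge(2)[of u] line_norm_ge(3)[of u] line_norm_ge(2)[of v] line_norm_ge(3)[of v]]
    unfolding w by blast
qed

lemma norms_nonneg: "0 \<le> point_norm v x" "0 \<le> line_norm v x"
  unfolding point_norm_def line_norm_def using pos by (simp_all add: le_max_iff_disj)

text \<open>\<open>idot\<close> vanishes exactly if the point lies on the line. Written in the forms
  at x it has three terms, in each of which the weights multiply to 1.\<close>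

lemma idot_le: "real_of_int \<bar>idot u v\<bar> \<le> 3 * point_norm u x * line_norm v x"
proof -
  obtain q p r a b c where uv: "u = (q, p, r)" "v = (a, b, c)" by (cases u; cases v)
  have "real_of_int (idot u v) = fst u * line_val v x - point_off u x * line_slope v x - snd (snd v) * point_tan u x"
    unfolding uv form_defs by (simp add: algebra_simps)
  then have "real_of_int \<bar>idot u v\<bar> \<le> \<bar>fst u\<bar> * \<bar>line_val v x\<bar> + \<bar>point_off u x\<bar> * \<bar>line_slope v x\<bar>
      + \<bar>point_tan u x\<bar> * \<bar>snd (snd v)\<bar>"
    unfolding of_int_abs abs_mult[symmetric] by (simp add: mult.commute)
  also have "\<dots> = (\<alpha> * \<beta> * \<gamma>) * (\<bar>fst u\<bar> * \<bar>line_val v x\<bar>) + (\<alpha> * \<beta> * \<gamma>) * (\<bar>point_off u x\<bar> * \<bar>line_slope v x\<bar>)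
      + (\<alpha> * \<beta> * \<gamma>) * (\<bar>point_tan u x\<bar> * \<bar>snd (snd v)\<bar>)" unfolding unit by simp
  also have "\<dots> = (\<alpha> * \<bar>fst u\<bar>) * (\<beta> * \<gamma> * \<bar>line_val v x\<bar>) + (\<beta> * \<bar>point_off u x\<bar>) * (\<alpha> * \<gamma> * \<bar>line_slope v x\<bar>)
      + (\<gamma> * \<bar>point_tan u x\<bar>) * (\<alpha> * \<beta> * \<bar>snd (snd v)\<bar>)" by (simp add: mult_ac)
  also have "\<dots> \<le> point_norm u x * line_norm v x + point_norm u x * line_norm v x + point_norm u x * line_norm v x"
    using pos line_norm_ge[of v x] point_norm_ge[of u x]
    by (intro add_mono mult_mono) (auto intro: norms_nonneg)
  finally show ?thesis by (simp add: mult_ac)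
qed

lemma idot_le': "real_of_int \<bar>idot u v\<bar> \<le> 3 * line_norm u x * point_norm v x"
  using idot_le[of v u x] unfolding idot_commute[of v u] by (simp only: mult_ac)

lemma norms_continuous: "continuous_on {s..t} (point_norm v)" "continuous_on {s..t} (line_norm v)"
  unfolding point_norm_def line_norm_def
  by (intro continuous_intros derivative_chain_continuous[OF point_chain] derivative_chain_continuous[OF line_chain])+

lemma norms_finite:
  "finite {v. \<exists>x\<in>{s..t}. point_norm v x \<le> 1}" "finite {v. \<exists>x\<in>{s..t}. line_norm v x \<le> 1}"
proof -
  obtain B where B: "0 \<le> B" "\<And>x. x \<in> {s..t} \<Longrightarrow> \<bar>x\<bar> \<le> B \<and> \<bar>f x\<bar> \<le> B \<and> \<bar>f1 x\<bar> \<le> B"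
    using bounded_on_curve by blast
  define K where "K = 1 / \<alpha> + 1 / \<beta> + 1 / \<gamma> + B / \<alpha> + B / \<beta>"
  define K' where "K' = 1 / (\<alpha> * \<beta>) + 1 / (\<alpha> * \<gamma>) + 1 / (\<beta> * \<gamma>) + B / (\<alpha> * \<beta>)
     + B * (1 / (\<alpha> * \<gamma>) + B / (\<alpha> * \<beta>))"
  have prod: "\<bar>a * b\<bar> \<le> A * B" if "\<bar>a\<bar> \<le> A" "\<bar>b\<bar> \<le> B" for a b A :: real
    unfolding abs_mult using that B by (intro mult_mono) auto
  show "finite {v. \<exists>x\<in>{s..t}. point_norm v x \<le> 1}"
  proof (rule finite_subset[OF _ finite_ivec_box[of K]], safe)
    fix q p r x assume x: "x \<in> {s..t}" and le: "point_norm (q, p, r) x \<le> 1"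
    note le' = order_trans[OF point_norm_ge(1) le] order_trans[OF point_norm_ge(2) le] order_trans[OF point_norm_ge(3) le]
    have a: "\<bar>real_of_int q\<bar> \<le> 1 / \<alpha>" and b: "\<bar>q * x - p\<bar> \<le> 1 / \<beta>"
      and c: "\<bar>q * f x - f1 x * (q * x - p) - r\<bar> \<le> 1 / \<gamma>"
      using le' pos unfolding form_defs by (simp_all add: pos_le_divide_eq mult.commute)
    have "\<bar>q * x\<bar> \<le> 1 / \<alpha> * B" "\<bar>q * f x\<bar> \<le> 1 / \<alpha> * B" "\<bar>(q * x - p) * f1 x\<bar> \<le> 1 / \<beta> * B"
      using prod[OF a, of x] prod[OF a, of "f x"] prod[OF b, of "f1 x"] B(2)[OF x] by simp_all
    then have d: "\<bar>q * x\<bar> \<le> B / \<alpha>" "\<bar>q * f x\<bar> \<le> B / \<alpha>" "\<bar>f1 x * (q * x - p)\<bar> \<le> B / \<beta>"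
      by (simp_all add: mult.commute)
    have nn: "0 \<le> 1 / \<alpha>" "0 \<le> 1 / \<beta>" "0 \<le> 1 / \<gamma>" "0 \<le> B / \<alpha>" "0 \<le> B / \<beta>" using pos B by simp_all
    show "\<bar>real_of_int q\<bar> \<le> K" unfolding K_def using a nn by linarith
    show "\<bar>real_of_int p\<bar> \<le> K" unfolding K_def using b d(1) nn by linarith
    show "\<bar>real_of_int r\<bar> \<le> K" unfolding K_def using c d nn by linarith
  qed
  show "finite {v. \<exists>x\<in>{s..t}. line_norm v x \<le> 1}"
  proof (rule finite_subset[OF _ finite_ivec_box[of K']], safe)
    fix a b c x assume x: "x \<in> {s..t}" and le: "line_norm (a, b, c) x \<le> 1"
    note le' = order_trans[OF line_norm_ge(1) le] order_trans[OF line_norm_ge(2) le] order_trans[OF line_norm_ge(3) le]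
    have c: "\<bar>real_of_int c\<bar> \<le> 1 / (\<alpha> * \<beta>)" and b: "\<bar>b + c * f1 x\<bar> \<le> 1 / (\<alpha> * \<gamma>)"
      and a: "\<bar>a + b * x + c * f x\<bar> \<le> 1 / (\<beta> * \<gamma>)"
      using le' pos unfolding form_defs by (simp_all add: pos_le_divide_eq mult.commute)
    have "\<bar>c * f1 x\<bar> \<le> 1 / (\<alpha> * \<beta>) * B" "\<bar>c * f x\<bar> \<le> 1 / (\<alpha> * \<beta>) * B"
      using prod[OF c, of "f1 x"] prod[OF c, of "f x"] B(2)[OF x] by simp_all
    then have d: "\<bar>c * f1 x\<bar> \<le> B / (\<alpha> * \<beta>)" "\<bar>c * f x\<bar> \<le> B / (\<alpha> * \<beta>)" by simp_all
    have b': "\<bar>real_of_int b\<bar> \<le> 1 / (\<alpha> * \<gamma>) + B / (\<alpha> * \<beta>)" using b d(1) by linarith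
    have "\<bar>b * x\<bar> \<le> (1 / (\<alpha> * \<gamma>) + B / (\<alpha> * \<beta>)) * B" using prod[OF b', of x] B(2)[OF x] by simp
    then have d': "\<bar>b * x\<bar> \<le> B * (1 / (\<alpha> * \<gamma>) + B / (\<alpha> * \<beta>))" by (simp add: mult.commute)
    have nn: "0 \<le> 1 / (\<alpha> * \<beta>)" "0 \<le> 1 / (\<alpha> * \<gamma>)" "0 \<le> 1 / (\<beta> * \<gamma>)" "0 \<le> B / (\<alpha> * \<beta>)"
      "0 \<le> B * (1 / (\<alpha> * \<gamma>) + B / (\<alpha> * \<beta>))" using pos B by simp_all
    show "\<bar>real_of_int a\<bar> \<le> K'" unfolding K'_def using a d d' nn by linarith
    show "\<bar>real_of_int b\<bar> \<le> K'" unfolding K'_def using b' nn by linarith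
    show "\<bar>real_of_int c\<bar> \<le> K'" unfolding K'_def using c nn by linarith
  qed
qed

lemma point_norm_reach:
  assumes "v \<noteq> (0, 0, 0)"
  shows "\<exists>x\<in>{s..t}. 1 / 5 \<le> point_norm v x"
proof (rule ccontr)
  assume "\<not> ?thesis"
  then have "\<gamma> * \<bar>point_tan v x\<bar> \<le> 1 / 5" if "x \<in> {s..t}" for x
    using that order_trans[OF point_norm_ge(3)[of v x]] by (meson linear)
  then have small: "\<bar>point_tan v x\<bar> \<le> 1 / (5 * \<gamma>)" if "x \<in> {s..t}" for x
    using that pos by (simp add: field_simps)
  have lt: "1 / (5 * \<gamma>) * reach_const < 1" using large(1) pos by (simp add: field_simps)
  note z = derivative_chain_small[OF point_chain mM(1) order_trans[OF mM(2,3)] st small lt[unfolded reach_const_def]]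
  obtain q p r where v: "v = (q, p, r)" by (cases v)
  have q: "q = 0" using z(1) v by simp
  have p: "p = 0" using z(2) q v by (simp add: form_defs)
  have r: "r = 0" using z(3) q p v by (simp add: form_defs)
  show False using q p r v assms by simp
qed

lemma line_norm_reach:
  assumes "v \<noteq> (0, 0, 0)"
  shows "\<exists>x\<in>{s..t}. 1 / 5 \<le> line_norm v x"
proof (rule ccontr)
  assume "\<not> ?thesis"
  then have "\<beta> * \<gamma> * \<bar>line_val v x\<bar> \<le> 1 / 5" if "x \<in> {s..t}" for x
    using that order_trans[OF line_norm_ge(3)[of v x]] by (meson linear)
  then have small: "\<bar>line_val v x\<bar> \<le> 1 / (5 * (\<beta> * \<gamma>))" if "x \<in> {s..t}" for x
    using that pos by (simp add: field_simps)
  have lt: "1 / (5 * (\<beta> * \<gamma>)) * reach_const < 1" using large(2) pos by (simp add: field_simps)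
  note z = derivative_chain_small[OF line_chain mM(1) order_trans[OF mM(2,3)] st small lt[unfolded reach_const_def]]
  obtain a b c where v: "v = (a, b, c)" by (cases v)
  have c: "c = 0" using z(1) v by simp
  have b: "b = 0" using z(2) c v by (simp add: form_defs)
  have a: "a = 0" using z(3) b c v by (simp add: form_defs)
  show False using a b c v assms by simp
qed

text \<open>The factor sqrt (5 * e) comes from \<rho> = 1/5 and \<tau> = 5 * e, so that \<tau> *
  \<rho> = e.\<close>

lemma norms_sublevel:
  assumes cd: "s \<le> c" "c < d" "d \<le> t" and y: "y \<in> {c..d}"
  shows "1 / 5 \<le> point_norm v y \<Longrightarrow>
      measure lebesgue {x\<in>{c..d}. point_norm v x \<le> e} \<le> 16 * M / m * sqrt (5 * e) * (d - c)"
    and "1 / 5 \<le> line_norm v y \<Longrightarrow>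
      measure lebesgue {x\<in>{c..d}. line_norm v x \<le> e} \<le> 16 * M / m * sqrt (5 * e) * (d - c)"
proof -
  have sub: "{c..d} \<subseteq> {s..t}" using cd by auto
  have w: "m \<le> M" "0 < \<alpha> * \<beta>" "0 < \<alpha> * \<gamma>" "0 < \<beta> * \<gamma>" "0 < (1 / 5 :: real)" "0 < 5 * e"
    using mM pos e by auto
  have e5: "5 * e * (1 / 5) = e" by simp
  show "measure lebesgue {x\<in>{c..d}. point_norm v x \<le> e} \<le> 16 * M / m * sqrt (5 * e) * (d - c)"
    if "1 / 5 \<le> point_norm v y"
    using derivative_chain_sublevel[OF derivative_chain_subset[OF point_chain sub] mM(1) w(1) cd(2) pos w(5,6) y
        that[unfolded point_norm_def]] unfolding e5 point_norm_def .
  show "measure lebesgue {x\<in>{c..d}. line_norm v x \<le> e} \<le> 16 * M / m * sqrt (5 * e) * (d - c)"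
    if "1 / 5 \<le> line_norm v y"
    using derivative_chain_sublevel[OF derivative_chain_subset[OF line_chain sub] mM(1) w(1) cd(2) w(2-6) y
        that[unfolded line_norm_def]] unfolding e5 line_norm_def .
qed

text \<open>\<open>True\<close> stands for points, \<open>False\<close> for lines.\<close>

sublocale dual_norms "\<lambda>\<sigma>. if \<sigma> then point_norm else line_norm" s t "16 * M / m * sqrt (5 * e)" e
proof
  show "s < t" "0 < e" "e < 1 / 5" using st e by auto
  show "0 \<le> 16 * M / m * sqrt (5 * e)" using mM e by simp
  show "real_of_int \<bar>idot u v\<bar> \<le> 3 * (if \<sigma> then point_norm else line_norm) u x *
      (if \<not> \<sigma> then point_norm else line_norm) v x" for u v x \<sigma>
    using idot_le[of u v x] idot_le'[of u v x] by (cases \<sigma>) simp_all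
  show "v \<noteq> (0, 0, 0) \<Longrightarrow> \<exists>x\<in>{s..t}. 1 / 5 \<le> (if \<sigma> then point_norm else line_norm) v x" for v \<sigma>
    using point_norm_reach[of v] line_norm_reach[of v] by (cases \<sigma>) simp_all
  show "measure lebesgue {x\<in>{c..d}. (if \<sigma> then point_norm else line_norm) v x \<le> e}
      \<le> 16 * M / m * sqrt (5 * e) * (d - c)"
    if "s \<le> c" "c < d" "d \<le> t" "y \<in> {c..d}" "1 / 5 \<le> (if \<sigma> then point_norm else line_norm) v y" for c d y v \<sigma>
    using norms_sublevel[OF that(1-4), of v] that(5) by (cases \<sigma>) simp_all
qed (simp_all add: norms_continuous norms_nonneg norms_scale line_norm_icross point_norm_icross norms_finite)

end

section \<open>Pigeonhole approximation outside the exceptional set\<close>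

text \<open>Dirichlet's argument: K * R + 1 indices fall into K * R boxes.\<close>

lemma simultaneous_approximation:
  fixes x y z :: real and K R :: nat
  assumes "0 < K" "0 < R"
  obtains q p r :: int where "0 < q" "q \<le> int (K * R)" "\<bar>q * x - p\<bar> < 1 / K"
    "\<bar>q * y - z * (q * x - p) - r\<bar> < 1 / R"
proof -
  define u where "u j = frac (real j * x)" for j :: nat
  \<comment> \<open>Subtracting z * \<open>u j\<close> rather than z * j * x makes the difference of
    two values equal to q * y - z * (q * x - p) exactly, because \<open>u j\<close> -
    \<open>u i\<close> is q * x - p.\<close>
  define w where "w j = real j * y - z * u j" for j :: nat
  define h where "h j = (\<lfloor>real K * u j\<rfloor>, \<lfloor>real R * frac (w j)\<rfloor>)" for j :: nat
  have "h ` {0..K * R} \<subseteq> {0..<int K} \<times> {0..<int R}"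
    unfolding h_def u_def using assms by (auto simp: floor_less_iff frac_lt_1)
  then have "card (h ` {0..K * R}) \<le> card ({0..<int K} \<times> {0..<int R})"
    by (intro card_mono) auto
  also have "\<dots> = K * R" by (simp add: card_cartesian_product)
  also have "\<dots> < card {0..K * R}" by simp
  finally have "\<not> inj_on h {0..K * R}" using card_image[of h "{0..K * R}"] by auto
  then obtain i j where ij: "i < j" "j \<le> K * R" "h i = h j"
    unfolding inj_on_def by (metis atLeastAtMost_iff linorder_neqE_nat)
  have close: "\<bar>v - v'\<bar> < 1 / real n" if "\<lfloor>real n * v\<rfloor> = \<lfloor>real n * v'\<rfloor>" "0 < n" for n :: nat and v v' :: real
  proof -
    have "\<bar>real n * v - real n * v'\<bar> < 1" using that(1) by linarith
    then have "real n * \<bar>v - v'\<bar> < 1" by (simp add: abs_mult flip: right_diff_distrib)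
    then show ?thesis using that(2) by (simp add: field_simps)
  qed
  have c1: "\<bar>u j - u i\<bar> < 1 / K" and c2: "\<bar>frac (w j) - frac (w i)\<bar> < 1 / R"
    using ij(3) assms by (auto simp: h_def intro!: close)
  define q where "q = int j - int i"
  define p where "p = \<lfloor>real j * x\<rfloor> - \<lfloor>real i * x\<rfloor>"
  define r where "r = \<lfloor>w j\<rfloor> - \<lfloor>w i\<rfloor>"
  have e1: "q * x - p = u j - u i" unfolding q_def p_def u_def frac_def by (simp add: algebra_simps)
  have "q * y - z * (q * x - p) - r = frac (w j) - frac (w i)"
    unfolding e1 unfolding q_def r_def frac_def w_def by (simp add: algebra_simps)
  moreover have "q \<le> int (K * R)" unfolding q_def using ij(2) by linarith
  moreover have "0 < q" unfolding q_def using ij(1) by simp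
  ultimately show thesis using that[of q p r] c1 c2 e1 by simp
qed

text \<open>The two approximation bounds from the pigeonhole principle say that the last two
  weighted forms are at most e. Where no vector is that short, the first form must exceed e, and
  this is the lower bound for q.\<close>

lemma (in curve) many_well_approximated_points:
  assumes e: "0 < e" "e < 1 / 5" "6 * (16 * M / m * sqrt (5 * e)) \<le> 1 / 2"
    and \<delta>: "0 < \<delta>" "\<delta> \<le> 1" "2 \<le> \<delta> * Q" "reach_const * \<delta> < 5 * e" "reach_const < 5 / 4 * e\<^sup>2 * Q"
  obtains A where "A \<in> lmeasurable" "A \<subseteq> {s..t}" "(t - s) / 2 \<le> measure lebesgue A"
    "\<And>x. x \<in> A \<Longrightarrow> \<exists>(q :: int) (p :: int) (r :: int). e ^ 3 / 4 * Q < q \<and> q \<le> Q \<and> \<bar>q * x - p\<bar> \<le> 4 / (\<delta> * Q) \<and>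
       \<bar>q * f x - f1 x * (q * x - p) - r\<bar> \<le> \<delta>"
proof -
  have Q: "0 < Q" using zero_less_mult_pos[of \<delta> Q] \<delta>(1,3) by linarith
  \<comment> \<open>With these weights norm at most e means \<open>q \<le> e ^ 3 / 4 * Q\<close>,
    offset at most 4 / (\<delta> * Q) and tangent form at most \<delta>. The first weight is then
    determined by the product being 1.\<close>
  interpret weighted_curve f f1 f2 s t m M "4 / (e\<^sup>2 * Q)" "e * \<delta> * Q / 4" "e / \<delta>" e
  proof
    show "0 < 4 / (e\<^sup>2 * Q)" "0 < e * \<delta> * Q / 4" "0 < e / \<delta>" using e \<delta> Q by simp_all
    show "4 / (e\<^sup>2 * Q) * (e * \<delta> * Q / 4) * (e / \<delta>) = 1" using e \<delta> Q by (simp add: power2_eq_square)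
    show "reach_const < 5 * (e / \<delta>)" using \<delta> by (simp add: field_simps)
    show "reach_const < 5 * (e * \<delta> * Q / 4 * (e / \<delta>))" using \<delta> by (simp add: power2_eq_square mult_ac)
  qed (use e in auto)
  define A where "A = {s..t} - short_set"
  have lm: "short_set \<in> lmeasurable" by (rule lmeasurable_compact[OF compact_short_set])
  have sub: "short_set \<subseteq> {s..t}" unfolding short_set_def by auto
  have A: "A \<in> lmeasurable" unfolding A_def using lm by (intro fmeasurable.Diff) auto
  have "measure lebesgue A = (t - s) - measure lebesgue short_set"
    unfolding A_def using measurable_measure_Diff[OF _ fmeasurableD[OF lm] sub] st by simp
  moreover have "measure lebesgue short_set \<le> 1 / 2 * (t - s)"
    using measure_short_set mult_right_mono[OF assms(3), of "t - s"] st by linarith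
  ultimately have mA: "(t - s) / 2 \<le> measure lebesgue A" by simp
  \<comment> \<open>R is about 1 / \<delta> and K about Q / R. Rounding R up and K down loses a
    factor 2 each time, whence the 4 in the offset bound.\<close>
  define R where "R = nat \<lceil>1 / \<delta>\<rceil>"
  have R: "1 / \<delta> \<le> real R" "real R \<le> 2 / \<delta>"
  proof -
    have "1 \<le> 1 / \<delta>" using \<delta> by simp
    then show "1 / \<delta> \<le> real R" "real R \<le> 2 / \<delta>" unfolding R_def by linarith+
  qed
  have R0: "0 < R" using R(1) \<delta>(1) by (metis less_le_trans of_nat_0_less_iff zero_less_divide_1_iff)
  define Y where "Y = Q / real R"
  define K where "K = nat \<lfloor>Y\<rfloor>"
  have "\<delta> * Q / 2 \<le> Y" unfolding Y_def using R(2) R0 \<delta> Q by (simp add: field_simps)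
  then have QR: "1 \<le> Y" "\<delta> * Q / 4 \<le> Y / 2" using \<delta>(3) by linarith+
  have K: "real K \<le> Y" "Y / 2 \<le> real K" "0 < K" 
  proof -
    have "1 \<le> \<lfloor>Y\<rfloor>" using QR(1) by simp
    moreover from this have "real K = real_of_int \<lfloor>Y\<rfloor>" unfolding K_def by simp
    ultimately show "real K \<le> Y" "Y / 2 \<le> real K" "0 < K" unfolding K_def by linarith+
  qed
  have KR: "real K * real R \<le> Q" using K(1) R0 unfolding Y_def by (simp add: field_simps)
  have "\<delta> * Q / 4 \<le> real K" using QR(2) K(2) by linarith
  then have invK: "1 / real K \<le> 4 / (\<delta> * Q)" using \<delta> Q K(3) by (simp add: field_simps)
  have invR: "1 / real R \<le> \<delta>" using R(1) R0 \<delta> by (simp add: field_simps)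
  have "\<exists>(q :: int) (p :: int) (r :: int). e ^ 3 / 4 * Q < q \<and> q \<le> Q \<and> \<bar>q * x - p\<bar> \<le> 4 / (\<delta> * Q) \<and>
       \<bar>q * f x - f1 x * (q * x - p) - r\<bar> \<le> \<delta>" if x: "x \<in> A" for x
  proof -
    obtain q p r :: int where qpr: "0 < q" "q \<le> int (K * R)" "\<bar>q * x - p\<bar> < 1 / K"
      "\<bar>q * f x - f1 x * (q * x - p) - r\<bar> < 1 / R"
      using simultaneous_approximation[OF K(3) R0] by metis
    have l: "\<bar>q * x - p\<bar> \<le> 4 / (\<delta> * Q)" using qpr(3) invK by linarith
    have t: "\<bar>q * f x - f1 x * (q * x - p) - r\<bar> \<le> \<delta>" using qpr(4) invR by linarith
    have "real_of_int q \<le> real K * real R" using qpr(2) by (metis of_int_le_iff of_int_of_nat_eq of_nat_mult)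
    then have qQ: "q \<le> Q" using KR by linarith
    have "e ^ 3 / 4 * Q < q"
    proof (rule ccontr)
      assume "\<not> e ^ 3 / 4 * Q < q"
      then have "4 / (e\<^sup>2 * Q) * real_of_int q \<le> 4 / (e\<^sup>2 * Q) * (e ^ 3 / 4 * Q)"
        using e Q by (intro mult_left_mono) auto
      also have "\<dots> = e" using e Q by (simp add: power2_eq_square power3_eq_cube)
      finally have 1: "4 / (e\<^sup>2 * Q) * \<bar>real_of_int (fst (q, p, r))\<bar> \<le> e" using qpr(1) by simp
      have "e * \<delta> * Q / 4 * \<bar>q * x - p\<bar> \<le> e * \<delta> * Q / 4 * (4 / (\<delta> * Q))"
        using e \<delta> Q l by (intro mult_left_mono) auto
      also have "\<dots> = e" using e \<delta> Q by simp
      finally have 2: "e * \<delta> * Q / 4 * \<bar>point_off (q, p, r) x\<bar> \<le> e" by (simp add: form_defs)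
      have "e / \<delta> * \<bar>q * f x - f1 x * (q * x - p) - r\<bar> \<le> e / \<delta> * \<delta>"
        using e \<delta> t by (intro mult_left_mono) auto
      also have "\<dots> = e" using \<delta> by simp
      finally have 3: "e / \<delta> * \<bar>point_tan (q, p, r) x\<bar> \<le> e" by (simp add: form_defs)
      have "point_norm (q, p, r) x \<le> e" unfolding point_norm_def using 1 2 3 by (intro max.boundedI)
      then have "x \<in> short_set"
        using nonzero_in_short_set[of "(q, p, r)" x True] qpr(1) x unfolding A_def by simp
      then show False using x unfolding A_def by simp
    qed
    then show ?thesis using qQ l t by blast
  qed
  then show thesis using that[OF A _ mA] unfolding A_def by auto
qed

section \<open>From integer vectors to rational points near the graph\<close>

lemma measure_le_card_cover:
  fixes A P :: "real set"
  assumes "finite P" "A \<in> lmeasurable" "0 \<le> H" "\<And>x. x \<in> A \<Longrightarrow> \<exists>y\<in>P. \<bar>x - y\<bar> \<le> H"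
  shows "measure lebesgue A \<le> real (card P) * (2 * H)"
proof -
  have "A \<subseteq> (\<Union>y\<in>P. {y - H..y + H})"
  proof
    fix x assume "x \<in> A"
    then obtain y where "y \<in> P" "\<bar>x - y\<bar> \<le> H" using assms(4) by blast
    then show "x \<in> (\<Union>y\<in>P. {y - H..y + H})" by (intro UN_I[of y]) auto
  qed
  then have "measure lebesgue A \<le> measure lebesgue (\<Union>y\<in>P. {y - H..y + H})"
    using assms by (intro measure_mono_fmeasurable fmeasurable.finite_UN) (auto intro: fmeasurableD)
  also have "\<dots> \<le> (\<Sum>y\<in>P. measure lebesgue {y - H..y + H})"
    using assms(1) by (intro measure_UNION_le) auto
  also have "\<dots> = real (card P) * (2 * H)" using assms(3) by simp
  finally show ?thesis .
qed

text \<open>The function f u - f1 x * u has derivative at most M * |y - x| between x and y, so the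
  mean value inequality gives the quadratic bound, without the usual factor 1/2.\<close>

lemma taylor_quadratic_bound:
  fixes f f1 f2 :: "real \<Rightarrow> real"
  assumes f: "\<And>x. x \<in> {a<..<b} \<Longrightarrow> (f has_real_derivative f1 x) (at x)"
    and f1: "\<And>x. x \<in> {a<..<b} \<Longrightarrow> (f1 has_real_derivative f2 x) (at x)"
    and f2: "\<And>x. x \<in> {a<..<b} \<Longrightarrow> \<bar>f2 x\<bar> \<le> M"
    and xy: "x \<in> {a<..<b}" "y \<in> {a<..<b}"
  shows "\<bar>f1 y - f1 x\<bar> \<le> M * \<bar>y - x\<bar>" "\<bar>f y - f x - f1 x * (y - x)\<bar> \<le> M * (y - x)\<^sup>2"
proof -
  have lip: "\<bar>f1 v - f1 u\<bar> \<le> M * \<bar>v - u\<bar>" if "u \<in> {a<..<b}" "v \<in> {a<..<b}" for u v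
    using field_differentiable_bound[of "{a<..<b}" f1 f2 M v u] f1 f2 that
    by (auto intro: has_field_derivative_at_within)
  show "\<bar>f1 y - f1 x\<bar> \<le> M * \<bar>y - x\<bar>" using lip[OF xy] .
  define S where "S = {a<..<b} \<inter> {min x y..max x y}"
  have M0: "0 \<le> M" using f2[OF xy(1)] by linarith
  have "convex S" unfolding S_def by (intro convex_Int) auto
  moreover have "((\<lambda>u. f u - f1 x * u) has_real_derivative f1 u - f1 x) (at u within S)" if "u \<in> S" for u
    using f[of u] that unfolding S_def
    by (auto intro!: derivative_eq_intros intro: has_field_derivative_at_within)
  moreover have "norm (f1 u - f1 x) \<le> M * \<bar>y - x\<bar>" if "u \<in> S" for u
  proof -
    have "\<bar>f1 u - f1 x\<bar> \<le> M * \<bar>u - x\<bar>" using lip[OF xy(1)] that unfolding S_def by auto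
    also have "\<dots> \<le> M * \<bar>y - x\<bar>" using that M0 unfolding S_def by (intro mult_left_mono) auto
    finally show ?thesis by simp
  qed
  moreover have "x \<in> S" "y \<in> S" unfolding S_def using xy by auto
  ultimately have "norm ((f y - f1 x * y) - (f x - f1 x * x)) \<le> M * \<bar>y - x\<bar> * norm (y - x)"
    by (intro field_differentiable_bound)
  then show "\<bar>f y - f x - f1 x * (y - x)\<bar> \<le> M * (y - x)\<^sup>2"
    by (simp add: algebra_simps power2_eq_square abs_mult_self_eq flip: abs_mult)
qed

lemma common_denom_rational:
  assumes "v \<in> \<rat> \<times> \<rat>"
  shows "0 < common_denom v" "real (common_denom v) * fst v \<in> \<int>" "real (common_denom v) * snd v \<in> \<int>"
proof -
  obtain a b where ab: "0 < b" "fst v = of_int a / of_int b" using assms by (cases v) (auto elim!: Rats_cases')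
  obtain c d where cd: "0 < d" "snd v = of_int c / of_int d" using assms by (cases v) (auto elim!: Rats_cases')
  have n: "real (nat (b * d)) = of_int b * of_int d" using ab cd by simp
  have "real (nat (b * d)) * fst v = of_int (d * a)" "real (nat (b * d)) * snd v = of_int (b * c)"
    unfolding n using ab cd by simp_all
  then have "0 < nat (b * d) \<and> real (nat (b * d)) * fst v \<in> \<int> \<and> real (nat (b * d)) * snd v \<in> \<int>"
    using ab cd by (metis Ints_of_int mult_pos_pos zero_less_nat_eq)
  then have "0 < common_denom v \<and> real (common_denom v) * fst v \<in> \<int> \<and> real (common_denom v) * snd v \<in> \<int>"
    unfolding common_denom_def by (rule LeastI)
  then show "0 < common_denom v" "real (common_denom v) * fst v \<in> \<int>" "real (common_denom v) * snd v \<in> \<int>"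
    by auto
qed

lemma common_denom_le:
  assumes "0 < q"
  shows "real (common_denom (real_of_int p / real_of_int q, real_of_int r / real_of_int q)) \<le> real_of_int q"
proof -
  have "common_denom (real_of_int p / real_of_int q, real_of_int r / real_of_int q) \<le> nat q"
    unfolding common_denom_def by (rule Least_le) (use assms in auto)
  then show ?thesis using assms by linarith
qed

text \<open>An infinite set would have cardinality 0 and defeat any lower bound. Here denominators
  and numerators are bounded.\<close>

lemma finite_rationals_near_graph:
  assumes "\<And>x. x \<in> I \<Longrightarrow> \<bar>x\<bar> \<le> B \<and> \<bar>f x\<bar> \<le> B"
  shows "finite {v \<in> \<rat> \<times> \<rat>. real (common_denom v) \<le> Q \<and> fst v \<in> I \<and> \<bar>f (fst v) - snd v\<bar> < E}"
proof (rule finite_surj)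
  define L where "L = \<lceil>Q * (B + E)\<rceil>"
  define L' where "L' = \<lceil>Q * B\<rceil>"
  define T where "T = {0..nat \<lfloor>Q\<rfloor>} \<times> {- L'..L'} \<times> {- L..L}"
  show "finite T" unfolding T_def by auto
  show "{v \<in> \<rat> \<times> \<rat>. real (common_denom v) \<le> Q \<and> fst v \<in> I \<and> \<bar>f (fst v) - snd v\<bar> < E}
    \<subseteq> (\<lambda>(n, p, r). (real_of_int p / real n, real_of_int r / real n)) ` T"
  proof
    fix v assume v: "v \<in> {v \<in> \<rat> \<times> \<rat>. real (common_denom v) \<le> Q \<and> fst v \<in> I \<and> \<bar>f (fst v) - snd v\<bar> < E}"
    define n where "n = common_denom v"
    have vr: "v \<in> \<rat> \<times> \<rat>" using v by simp
    have n: "0 < n" "real n \<le> Q" using common_denom_rational(1)[OF vr] v unfolding n_def by simp_all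
    obtain p where p: "real n * fst v = of_int p"
      using common_denom_rational(2)[OF vr] unfolding n_def by (auto elim: Ints_cases)
    obtain r where r: "real n * snd v = of_int r"
      using common_denom_rational(3)[OF vr] unfolding n_def by (auto elim: Ints_cases)
    have b: "\<bar>fst v\<bar> \<le> B" "\<bar>f (fst v)\<bar> \<le> B" using assms v by auto
    have b2: "\<bar>snd v\<bar> \<le> B + E" using b v by auto
    have "\<bar>real_of_int p\<bar> \<le> Q * B"
      unfolding p[symmetric] abs_mult using n b by (intro mult_mono) auto
    moreover have "\<bar>real_of_int r\<bar> \<le> Q * (B + E)"
      unfolding r[symmetric] abs_mult using n b2 by (intro mult_mono) auto
    ultimately have "p \<in> {- L'..L'}" "r \<in> {- L..L}" unfolding L_def L'_def by (auto simp: abs_le_iff) linarith+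
    moreover have "n \<in> {0..nat \<lfloor>Q\<rfloor>}" using n by (simp add: le_nat_floor)
    moreover have "v = (real_of_int p / real n, real_of_int r / real n)"
      using n p r by (cases v) (simp add: field_simps)
    ultimately show "v \<in> (\<lambda>(n, p, r). (real_of_int p / real n, real_of_int r / real n)) ` T"
      unfolding T_def by (intro image_eqI[of _ _ "(n, p, r)"]) auto
  qed
qed

lemma rational_near_point:
  fixes x \<kappa> E Q :: real and q p :: int
  assumes pos: "0 < \<kappa>" "0 < Q" "0 < E" and q: "\<kappa> * Q < q"
    and l: "\<bar>q * x - p\<bar> \<le> 8 / (\<kappa> * E * Q)"
  shows "\<bar>x - p / q\<bar> \<le> 8 / (\<kappa>\<^sup>2 * E * Q\<^sup>2)"
proof -
  have q0: "0 < real_of_int q" using less_trans[OF mult_pos_pos[OF pos(1,2)] q] by simp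
  have "\<kappa> * Q * \<bar>x - p / q\<bar> \<le> q * \<bar>x - p / q\<bar>" using q by (intro mult_right_mono) auto
  also have "\<dots> = \<bar>q * x - p\<bar>" using q0 by (simp add: field_simps flip: abs_mult_pos)
  finally have "\<kappa> * Q * \<bar>x - p / q\<bar> \<le> 8 / (\<kappa> * E * Q)" using l by linarith
  then show ?thesis using pos by (simp add: field_simps power2_eq_square)
qed

text \<open>Dividing the tangent form by q gives the vertical distance from (p / q, r / q) to the
  tangent at x. It uses one half of the tolerance E / Q; the other half is for the Taylor error
  between tangent and graph.\<close>

lemma rational_near_graph:
  fixes f f1 f2 :: "real \<Rightarrow> real" and a b x M \<kappa> E Q :: real and q p r :: int
  assumes f: "\<And>x. x \<in> {a<..<b} \<Longrightarrow> (f has_real_derivative f1 x) (at x)"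
    and f1: "\<And>x. x \<in> {a<..<b} \<Longrightarrow> (f1 has_real_derivative f2 x) (at x)"
    and f2: "\<And>x. x \<in> {a<..<b} \<Longrightarrow> \<bar>f2 x\<bar> \<le> M"
    and x: "x \<in> {a<..<b}" "p / q \<in> {a<..<b}"
    and pos: "0 < \<kappa>" "0 < Q" "0 < E" and q: "\<kappa> * Q < q"
    and l: "\<bar>q * x - p\<bar> \<le> 8 / (\<kappa> * E * Q)"
    and t: "\<bar>q * f x - f1 x * (q * x - p) - r\<bar> \<le> \<kappa> * E / 2"
    and large: "1 \<le> E * Q" "128 * M \<le> \<kappa> ^ 4 * (E * Q)"
  shows "\<bar>f (p / q) - r / q\<bar> < E / Q"
proof -
  have q0: "0 < real_of_int q" using less_trans[OF mult_pos_pos[OF pos(1,2)] q] by simp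
  define y where "y = p / q"
  have xy: "q * (x - y) = q * x - p" unfolding y_def using q0 by (simp add: algebra_simps)
  have d: "\<bar>x - y\<bar> \<le> 8 / (\<kappa>\<^sup>2 * E * Q\<^sup>2)" unfolding y_def by (rule rational_near_point[OF pos q l])
  have M0: "0 \<le> M" using f2[OF x(1)] by linarith
  have "\<bar>f y - f x - f1 x * (y - x)\<bar> \<le> M * (y - x)\<^sup>2"
    using taylor_quadratic_bound(2)[OF f f1 f2 x] unfolding y_def .
  also have "(y - x)\<^sup>2 = \<bar>x - y\<bar>\<^sup>2" by (simp add: power2_commute)
  also have "M * \<bar>x - y\<bar>\<^sup>2 \<le> M * (8 / (\<kappa>\<^sup>2 * E * Q\<^sup>2))\<^sup>2"
    using d M0 by (intro mult_left_mono power_mono) auto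
  \<comment> \<open>The Taylor error requires
    \<open>128 * M \<le> \<kappa> ^ 4 * (E * Q) ^ 3\<close>. This is where E * Q, that is Q * \<psi>
    Q, must be large.\<close>
  also have "\<dots> \<le> E / (2 * Q)"
  proof -
    have "E * Q * 1 \<le> E * Q * (E * Q)\<^sup>2" using large(1) pos by (intro mult_left_mono) auto
    then have "128 * M \<le> \<kappa> ^ 4 * (E * Q * (E * Q)\<^sup>2)"
      using large(2) pos by (smt (verit) mult_left_mono zero_le_power)
    then have "128 * M * Q \<le> \<kappa> ^ 4 * (E * Q * (E * Q)\<^sup>2) * Q" using pos by (intro mult_right_mono) auto
    also have "\<dots> = E * (\<kappa>\<^sup>2 * E * Q\<^sup>2)\<^sup>2" by (simp add: power2_eq_square power4_eq_xxxx mult_ac)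
    finally have le: "128 * M * Q \<le> E * (\<kappa>\<^sup>2 * E * Q\<^sup>2)\<^sup>2" .
    define D where "D = (\<kappa>\<^sup>2 * E * Q\<^sup>2)\<^sup>2"
    have D: "0 < D" unfolding D_def using pos by simp
    have "M * (64 / D) \<le> E / (2 * Q)"
      using le D pos unfolding D_def[symmetric] by (simp add: field_simps)
    then show ?thesis unfolding D_def by (simp add: power_divide)
  qed
  finally have T: "\<bar>f y - f x - f1 x * (y - x)\<bar> \<le> E / (2 * Q)" .
  have "\<bar>(q * f x - f1 x * (q * x - p) - r) / q\<bar> \<le> (\<kappa> * E / 2) / q"
    using divide_right_mono[OF t, of q] q0 by (simp only: abs_divide abs_of_pos less_imp_le)
  also have "\<dots> < (\<kappa> * E / 2) / (\<kappa> * Q)" using q q0 pos by (intro divide_strict_left_mono) simp_all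
  also have "\<dots> = E / (2 * Q)" using pos by simp
  finally have F: "\<bar>(q * f x - f1 x * (q * x - p) - r) / q\<bar> < E / (2 * Q)" .
  have "(q * f x - f1 x * (q * x - p) - r) / q = f x + f1 x * (y - x) - r / q"
    unfolding xy[symmetric] using q0 by (simp add: field_simps)
  then have "\<bar>f y - r / q\<bar> < E / (2 * Q) + E / (2 * Q)" using T F by linarith
  then show "\<bar>f (p / q) - r / q\<bar> < E / Q" unfolding y_def by simp
qed

section \<open>Choice of the constants and conclusion\<close>

text \<open>Clamping at 1 lets the constant factor 1 occurring in both derivative chains obey the
  same bounds as the second derivative.\<close>

lemma second_derivative_bounds:
  assumes "0 < (INF x\<in>S. ereal \<bar>g x\<bar>)" "(SUP x\<in>S. ereal \<bar>g x\<bar>) < \<infinity>"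
  obtains m M where "0 < m" "m \<le> 1" "1 \<le> M" "\<And>x. x \<in> S \<Longrightarrow> m \<le> \<bar>g x\<bar> \<and> \<bar>g x\<bar> \<le> M"
proof -
  obtain m0 where m0: "0 < ereal m0" "ereal m0 < (INF x\<in>S. ereal \<bar>g x\<bar>)"
    using ereal_dense2[OF assms(1)] by blast
  obtain M0 where M0: "(SUP x\<in>S. ereal \<bar>g x\<bar>) < ereal M0"
    using ereal_dense2[OF assms(2)] by blast
  have "min m0 1 \<le> \<bar>g x\<bar> \<and> \<bar>g x\<bar> \<le> max M0 1" if "x \<in> S" for x
  proof -
    have "ereal m0 < ereal \<bar>g x\<bar>" using m0(2) INF_lower[OF that] by (rule less_le_trans)
    moreover have "ereal \<bar>g x\<bar> < ereal M0" using SUP_upper[OF that] M0 by (rule le_less_trans)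
    ultimately show ?thesis by auto
  qed
  then show thesis using that[of "min m0 1" "max M0 1"] m0 by simp
qed

text \<open>The margin \<mu> on both sides keeps p / q inside I when x is in the middle
  part.\<close>

lemma interval_middle:
  fixes I :: "real set"
  assumes "is_interval I" "measure lborel I \<noteq> 0"
  obtains s t \<mu> where "s < t" "0 < \<mu>" "{s - \<mu>..t + \<mu>} \<subseteq> I"
proof -
  obtain u v where uv: "u \<in> I" "v \<in> I" "u < v"
  proof -
    have "I \<noteq> {}" using assms(2) by auto
    then obtain x where x: "x \<in> I" by blast
    have "I \<noteq> {x}" using assms(2) by auto
    then obtain y where "y \<in> I" "y \<noteq> x" using x by blast
    then show thesis using that[of x y] that[of y x] x by (cases x y rule: linorder_cases) auto
  qed
  define \<mu> where "\<mu> = (v - u) / 3"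
  have "{u..v} \<subseteq> I" using assms(1) uv unfolding is_interval_1 by (meson atLeastAtMost_iff subsetI)
  moreover have "{(u + \<mu>) - \<mu>..(v - \<mu>) + \<mu>} = {u..v}" by simp
  ultimately show thesis using that[of "u + \<mu>" "v - \<mu>" \<mu>] uv unfolding \<mu>_def by (simp add: field_simps)
qed

theorem theorem6:
  fixes a b :: real and f :: "real \<Rightarrow> real" and I :: "real set"
  assumes "a < b"
    and "Ck_on 3 f {a<..<b}"
    and "0 < (INF x\<in>{a<..<b}. ereal \<bar>(deriv ^^ 2) f x\<bar>)"
    and "(INF x\<in>{a<..<b}. ereal \<bar>(deriv ^^ 2) f x\<bar>)
           \<le> (SUP x\<in>{a<..<b}. ereal \<bar>(deriv ^^ 2) f x\<bar>)"
    and "(SUP x\<in>{a<..<b}. ereal \<bar>(deriv ^^ 2) f x\<bar>) < \<infinity>"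
    and "is_interval I" and "I \<subseteq> {a<..<b}"
  shows "\<exists>c>0. \<forall>\<psi> :: real \<Rightarrow> real.
           approximating_function \<psi> \<longrightarrow>
           (\<psi> \<longlongrightarrow> 0) at_top \<longrightarrow>
           ((\<lambda>t. 1 / (t * \<psi> t)) \<longlongrightarrow> 0) at_top \<longrightarrow>
           (\<forall>\<^sub>F Q in at_top. real (N_count f Q \<psi> I) \<ge> c * Q\<^sup>2 * \<psi> Q * measure lborel I)"
proof (cases "measure lborel I = 0")
  case True
  then show ?thesis by (intro exI[of _ 1]) simp
next
  case False
  define f1 f2 where "f1 = deriv f" and "f2 = (deriv ^^ 2) f"
  have df: "(f has_real_derivative f1 x) (at x)" and df1: "(f1 has_real_derivative f2 x) (at x)"
    if x: "x \<in> {a<..<b}" for x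
  proof -
    have "(deriv ^^ 0) f field_differentiable at x" "(deriv ^^ 1) f field_differentiable at x"
      using assms(2) x unfolding Ck_on_def by (metis zero_less_numeral, metis one_less_numeral_iff semiring_norm(77))
    then show "(f has_real_derivative f1 x) (at x)" "(f1 has_real_derivative f2 x) (at x)"
      unfolding f1_def f2_def by (simp_all add: numeral_2_eq_2 DERIV_deriv_iff_field_differentiable)
  qed
  obtain m M where mM: "0 < m" "m \<le> 1" "1 \<le> M"
    and df2: "\<And>x. x \<in> {a<..<b} \<Longrightarrow> m \<le> \<bar>f2 x\<bar> \<and> \<bar>f2 x\<bar> \<le> M"
    using second_derivative_bounds[OF assms(3,5)] unfolding f2_def by metis
  obtain s t \<mu> where mid: "s < t" "0 < \<mu>" "{s - \<mu>..t + \<mu>} \<subseteq> I"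
    using interval_middle[OF assms(6) False] by metis
  have stab: "{s..t} \<subseteq> {a<..<b}" using mid assms(7) by fastforce
  interpret curve f f1 f2 s t m M
    by standard (use mid(1) mM df df1 df2 stab in auto)
  obtain e where e: "0 < e" "e < 1 / 5" "6 * (16 * M / m * sqrt (5 * e)) \<le> 1 / 2"
  proof
    \<comment> \<open>96 * M / m is k / 2, and for e = \<open>1 / (10 * k\<^sup>2)\<close> the
      square root of 5 * e is at most 1 / k.\<close>
    define k where "k = 192 * M / m"
    have k: "1 \<le> k" unfolding k_def using mM by (simp add: field_simps)
    show "0 < 1 / (10 * k\<^sup>2)" using k by simp
    have "1 \<le> k\<^sup>2" using k by simp
    then have "5 < 10 * k\<^sup>2" by linarith
    then show "1 / (10 * k\<^sup>2) < 1 / 5" by (intro divide_strict_left_mono) auto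
    have "sqrt (5 * (1 / (10 * k\<^sup>2))) \<le> sqrt ((1 / k)\<^sup>2)" using k by (intro real_sqrt_le_mono) (simp add: field_simps power2_eq_square)
    also have "\<dots> = 1 / k" using k by simp
    finally have "k / 2 * sqrt (5 * (1 / (10 * k\<^sup>2))) \<le> k / 2 * (1 / k)" using k by (intro mult_left_mono) auto
    also have "\<dots> = 1 / 2" using k by simp
    finally show "6 * (16 * M / m * sqrt (5 * (1 / (10 * k\<^sup>2)))) \<le> 1 / 2" unfolding k_def by simp
  qed
  define \<kappa> where "\<kappa> = e ^ 3 / 4"
  have \<kappa>: "0 < \<kappa>" unfolding \<kappa>_def using e by simp
  \<comment> \<open>I may fail to be compact, so f is bounded on it by Taylor expansion at
    s.\<close>
  define B where "B = \<bar>a\<bar> + \<bar>b\<bar> + \<bar>f s\<bar> + \<bar>f1 s\<bar> * (b - a) + M * (b - a)\<^sup>2"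
  have sab: "s \<in> {a<..<b}" using subsetD[OF stab, of s] mid(1) by simp
  have bound: "\<bar>x\<bar> \<le> B \<and> \<bar>f x\<bar> \<le> B" if "x \<in> I" for x
  proof -
    have x: "x \<in> {a<..<b}" using that assms(7) by auto
    have "\<bar>f x - f s - f1 s * (x - s)\<bar> \<le> M * (x - s)\<^sup>2"
      using taylor_quadratic_bound(2)[OF df df1 _ sab x] df2 by blast
    moreover have "M * (x - s)\<^sup>2 \<le> M * (b - a)\<^sup>2"
      using x sab mM by (intro mult_left_mono) (auto simp: abs_le_square_iff[symmetric])
    moreover have "\<bar>f1 s * (x - s)\<bar> \<le> \<bar>f1 s\<bar> * (b - a)"
      unfolding abs_mult using x sab by (intro mult_left_mono) auto
    moreover have "0 \<le> M * (b - a)\<^sup>2" "0 \<le> \<bar>f1 s\<bar> * (b - a)" using mM assms(1) by simp_all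
    ultimately show ?thesis using x unfolding B_def by auto
  qed
  have I0: "0 < measure lborel I" using False by (simp add: zero_less_measure_iff)
  \<comment> \<open>From (t - s) / 2 \<le> card P * 2 * H with H =
    \<open>8 / (\<kappa>\<^sup>2 * E * Q\<^sup>2)\<close>; the factor |I| of the claim is divided
    out. Nothing here depends on \<psi>.\<close>
  define c where "c = \<kappa>\<^sup>2 * (t - s) / (32 * measure lborel I)"
  have c: "0 < c" unfolding c_def using \<kappa> mid I0 by simp
  show ?thesis
  proof (intro exI[of _ c] conjI c allI impI)
    fix \<psi> :: "real \<Rightarrow> real"
    assume \<psi>: "approximating_function \<psi>" "(\<psi> \<longlongrightarrow> 0) at_top" "((\<lambda>t. 1 / (t * \<psi> t)) \<longlongrightarrow> 0) at_top"
    \<comment> \<open>Lower bounds wanted for Q * \<psi> Q, in this order: for the Taylor error, for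
      \<delta> * Q \<ge> 2, again for the Taylor error, and for H \<le> \<mu>.\<close>
    define W where "W = 1 + 4 / \<kappa> + 128 * M / \<kappa> ^ 4 + 8 / (\<kappa>\<^sup>2 * \<mu>)"
    have W: "1 \<le> W" "4 / \<kappa> \<le> W" "128 * M / \<kappa> ^ 4 \<le> W" "8 / (\<kappa>\<^sup>2 * \<mu>) \<le> W"
    proof -
      have "0 \<le> 4 / \<kappa>" "0 \<le> 128 * M / \<kappa> ^ 4" "0 \<le> 8 / (\<kappa>\<^sup>2 * \<mu>)" using \<kappa> mM mid by simp_all
      then show "1 \<le> W" "4 / \<kappa> \<le> W" "128 * M / \<kappa> ^ 4 \<le> W" "8 / (\<kappa>\<^sup>2 * \<mu>) \<le> W" unfolding W_def by linarith+
    qed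
    define \<epsilon> where "\<epsilon> = min (2 / \<kappa>) (5 * e / (reach_const * \<kappa>))"
    have rc: "0 < reach_const" using reach_const_ge by simp
    have \<epsilon>: "0 < \<epsilon>" unfolding \<epsilon>_def using \<kappa> e rc by simp
    have ev: "eventually (\<lambda>Q. \<psi> Q < \<epsilon>) at_top" "eventually (\<lambda>Q. 1 / (Q * \<psi> Q) < 1 / W) at_top"
      using order_tendstoD(2)[OF \<psi>(2) \<epsilon>] order_tendstoD(2)[OF \<psi>(3), of "1 / W"] W(1) by auto
    show "\<forall>\<^sub>F Q in at_top. real (N_count f Q \<psi> I) \<ge> c * Q\<^sup>2 * \<psi> Q * measure lborel I"
      using ev eventually_ge_at_top[of 1] eventually_gt_at_top[of "4 * reach_const / (5 * e\<^sup>2)"]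
    proof eventually_elim
      case (elim Q)
      define E where "E = \<psi> Q"
      have Q: "0 < Q" "1 \<le> Q" using elim(3) by auto
      have E: "0 < E" unfolding E_def using \<psi>(1) Q unfolding approximating_function_def by simp
      have "1 / (Q * E) < 1 / W" using elim(2) unfolding E_def .
      then have EQ: "W < E * Q" using E Q W(1) by (simp add: field_simps)
      have E\<epsilon>: "E < 2 / \<kappa>" "E < 5 * e / (reach_const * \<kappa>)" using elim(1) unfolding E_def \<epsilon>_def by simp_all
      \<comment> \<open>After division by q > \<kappa> * Q a tangent form of size \<delta> uses half
        of the tolerance E / Q.\<close>
      define \<delta> where "\<delta> = \<kappa> * E / 2"
      have \<delta>: "0 < \<delta>" "\<delta> \<le> 1" "2 \<le> \<delta> * Q" "reach_const * \<delta> < 5 * e"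
      proof -
        show "0 < \<delta>" unfolding \<delta>_def using \<kappa> E by simp
        show "\<delta> \<le> 1" unfolding \<delta>_def using E\<epsilon>(1) \<kappa> by (simp add: field_simps)
        have "4 / \<kappa> \<le> E * Q" using EQ W(2) by linarith
        then show "2 \<le> \<delta> * Q" unfolding \<delta>_def using \<kappa> by (simp add: field_simps)
        have "reach_const * (\<kappa> * E) < 5 * e" using E\<epsilon>(2) \<kappa> rc by (simp add: field_simps)
        moreover have "0 < reach_const * (\<kappa> * E)" using rc \<kappa> E by simp
        ultimately show "reach_const * \<delta> < 5 * e" unfolding \<delta>_def by simp
      qed
      \<comment> \<open>The condition in \<open>large\<close> for lines, as 5 * \<beta> * \<gamma>
        is \<open>5 / 4 * e\<^sup>2 * Q\<close>.\<close>
      have rQ: "reach_const < 5 / 4 * e\<^sup>2 * Q" using elim(4) e by (simp add: field_simps)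
      obtain A where A: "A \<in> lmeasurable" "A \<subseteq> {s..t}" "(t - s) / 2 \<le> measure lebesgue A"
        "\<And>x. x \<in> A \<Longrightarrow> \<exists>(q :: int) (p :: int) (r :: int). e ^ 3 / 4 * Q < q \<and> q \<le> Q \<and> \<bar>q * x - p\<bar> \<le> 4 / (\<delta> * Q) \<and>
           \<bar>q * f x - f1 x * (q * x - p) - r\<bar> \<le> \<delta>"
        using many_well_approximated_points[OF e \<delta> rQ] by metis
      define P where "P = {v \<in> \<rat> \<times> \<rat>. real (common_denom v) \<le> Q \<and> fst v \<in> I \<and> \<bar>f (fst v) - snd v\<bar> < \<psi> Q / Q}"
      have P: "finite P" unfolding P_def by (rule finite_rationals_near_graph[OF bound])
      define H where "H = 8 / (\<kappa>\<^sup>2 * E * Q\<^sup>2)"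
      have H0: "0 \<le> H" unfolding H_def using \<kappa> E by simp
      have H\<mu>: "H \<le> \<mu>"
      proof -
        have "8 / (\<kappa>\<^sup>2 * \<mu>) \<le> E * Q * 1" using EQ W(4) by linarith
        also have "\<dots> \<le> E * Q * Q" using E Q by (intro mult_left_mono) auto
        finally show ?thesis unfolding H_def using \<kappa> mid E Q by (simp add: field_simps power2_eq_square)
      qed
      have "\<exists>y\<in>fst ` P. \<bar>x - y\<bar> \<le> H" if x: "x \<in> A" for x
      proof -
        obtain q p r :: int where qpr: "\<kappa> * Q < q" "q \<le> Q" "\<bar>q * x - p\<bar> \<le> 4 / (\<delta> * Q)"
          "\<bar>q * f x - f1 x * (q * x - p) - r\<bar> \<le> \<kappa> * E / 2"
          using A(4)[OF x] unfolding \<kappa>_def[symmetric] unfolding \<delta>_def by blast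
        have l: "\<bar>q * x - p\<bar> \<le> 8 / (\<kappa> * E * Q)" using qpr(3) unfolding \<delta>_def by simp
        have q0: "0 < q" using qpr(1) \<kappa> Q by (smt (verit) mult_pos_pos of_int_0_less_iff)
        have xst: "x \<in> {s..t}" using x A(2) by blast
        have near: "\<bar>x - p / q\<bar> \<le> H"
          unfolding H_def by (rule rational_near_point[OF \<kappa> Q(1) E qpr(1) l])
        then have "p / q \<in> {s - \<mu>..t + \<mu>}" using H\<mu> xst by auto
        then have pI: "p / q \<in> I" using mid(3) by blast
        have "1 \<le> E * Q" using EQ W(1) by linarith
        moreover have "128 * M / \<kappa> ^ 4 \<le> E * Q" using EQ W(3) by linarith
        then have "128 * M \<le> \<kappa> ^ 4 * (E * Q)" using \<kappa> by (simp add: field_simps)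
        ultimately have "\<bar>f (p / q) - r / q\<bar> < E / Q"
          using rational_near_graph[OF df df1 _ _ _ \<kappa> Q(1) E qpr(1) l qpr(4)] df2 xst stab pI assms(7) by blast
        moreover have "real (common_denom (p / q, r / q)) \<le> Q" using common_denom_le[OF q0, of p r] qpr(2) by linarith
        ultimately have "(p / q, r / q) \<in> P" unfolding P_def E_def using pI by simp
        then show ?thesis using near by (metis fst_conv image_eqI)
      qed
      then have "measure lebesgue A \<le> real (card (fst ` P)) * (2 * H)"
        using P A(1) H0 by (intro measure_le_card_cover) auto
      \<comment> \<open>Counted points with the same first coordinate merge in the projection, which
        only helps a lower bound.\<close>
      also have "\<dots> \<le> real (card P) * (2 * H)"
        using card_image_le[OF P, of fst] H0 by (intro mult_right_mono) auto
      finally have "(t - s) / 2 \<le> real (card P) * (2 * H)" using A(3) by linarith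
      then have "\<kappa>\<^sup>2 * (t - s) / 32 * (Q\<^sup>2 * E) \<le> real (card P)"
        unfolding H_def using \<kappa> E Q by (simp add: field_simps)
      moreover have "c * Q\<^sup>2 * \<psi> Q * measure lborel I = \<kappa>\<^sup>2 * (t - s) / 32 * (Q\<^sup>2 * E)"
        unfolding c_def E_def using I0 by (simp add: field_simps)
      ultimately show ?case unfolding N_count_def P_def by (simp only:)
    qed
  qed
qed

end
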